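(* Consider the problem $\min_{x\in\operatorname{dom}\Psi}[\tilde f(x)=f(x)+\Psi(x)]$, where $f$ is convex with $\operatorname{dom} f=\mathbb{E}$ and satisfies the Regularity Assumption, and $\Psi$ is a closed convex function. Let $\epsilon>0$ and $0<L_0\le2\gamma_f(\epsilon)$. Then all iterations of the method UFGM (described in the context) are well defined and $$L_{k+1}\ \le\ 2\gamma_f(\epsilon\,\tau_k),\qquad\tau_k=\frac{a_{k+1}}{A_{k+1}},\qquad k\ge0.$$ Moreover, for all $k\ge0$, $$\tau_{k+1}\ \le\ \tau_k\ \le\ \frac{2}{k+1},$$ and $$A_k\Big(\tilde f(y_k)-\tfrac12\epsilon\Big)\ \le\ \phi_k^*:=\min_{x\in\operatorname{dom}\Psi}\phi_k(x).$$
   Context: $\mathbb{E}$ is a finite-dimensional real linear space with dual $\mathbb{E}^*$; $\langle g,x\rangle$ is the value of $g\in\mathbb{E}^*$ at $x$; $\|\cdot\|$ is an arbitrary fixed norm on $\mathbb{E}$. $f:\mathbb{E}\to\mathbb{R}$ is convex and not affine; $\nabla f(x)\in\partial f(x)$ is its gradient (subgradient). $\Psi$ is closed convex with $\operatorname{dom}\Psi\subseteq\mathbb{E}$, $\operatorname{int}(\operatorname{dom}\Psi)\ne\emptyset$. Global Curvature Bound: $\hat\mu(t)=\sup\big\{\frac{\alpha f(x)+(1-\alpha)f(y)-f(\alpha x+(1-\alpha)y)}{\alpha(1-\alpha)}:\ x,y\in\mathbb{E},\ \alpha\in(0,1),\ \|x-y\|\le t\big\}$, $t\ge0$. Regularity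 Assumption: $\hat\mu(t)<+\infty$ for all $t\ge0$ and $\lim_{\tau\to+0}\frac1\tau\hat\mu(\tau)=0$. The complexity gauge $s_f$ is the inverse function of $\hat\mu$: $\hat\mu(s_f(\epsilon))=\epsilon$, $\epsilon\ge0$. For $t>0$: $\gamma_f(t)=t/s_f^2(t/2)$. Prox-function: $d$ is a differentiable convex function on $\operatorname{dom}\Psi$ with $d(y)\ge d(x)+\langle\nabla d(x),y-x\rangle+\frac12\|y-x\|^2$ for $x\in\operatorname{int}(\operatorname{dom}\Psi)$, $y\in\operatorname{dom}\Psi$; $x_0=\operatorname{arg\,min}_{x\in\operatorname{dom}\Psi}d(x)$ and $d(x_0)=0$. Bregman distance: $\beta_d(x,y)=d(y)-d(x)-\langle\nabla d(x),y-x\rangle$. The auxiliary minimization problems below are assumed to be solvable. Universal Fast Gradient Method (UFGM). Choose $L_0>0$, $\epsilon>0$. Define $\phi_0(x)=\beta_d(x_0,x)$, $y_0=x_0$, $A_0=0$. For $k\ge0$ do: 1. Find $v_k=\operatorname{arg\,min}_{x\in\operatorname{dom}\Psi}\phi_k(x)$. 2. Find the smallest integer $i_k\ge0$ such that the coefficient $a_{k+1,i_k}>0$ computed from $a_{k+1,i_k}^2=\frac1{2^{i_k}L_k}(A_k+a_{k+1,i_k})$ and used in the definitions $A_{k+1,i_k}=A_k+a_{k+1,i_k}$, $\tau_{k,i_k}=a_{k+1,i_k}/A_{k+1,i_k}$, $x_{k+1,i_k}=\tau_{k,i_k}v_k+(1-\tau_{k,i_k})y_k$, $\hat x_{k+1,i_k}=\operatorname{arg\,min}_{y\in\operatorname{dom}\Psi}\{\beta_d(v_k,y)+a_{k+1,i_k}[\langle\nabla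 f(x_{k+1,i_k}),y\rangle+\Psi(y)]\}$, $y_{k+1,i_k}=\tau_{k,i_k}\hat x_{k+1,i_k}+(1-\tau_{k,i_k})y_k$, ensures $$f(y_{k+1,i_k})\le f(x_{k+1,i_k})+\langle\nabla f(x_{k+1,i_k}),y_{k+1,i_k}-x_{k+1,i_k}\rangle+2^{i_k-1}L_k\|y_{k+1,i_k}-x_{k+1,i_k}\|^2+\frac\epsilon2\tau_{k,i_k}.$$ 3. Set $x_{k+1}=x_{k+1,i_k}$, $y_{k+1}=y_{k+1,i_k}$, $a_{k+1}=a_{k+1,i_k}$, $\tau_k=\tau_{k,i_k}$, $A_{k+1}=A_k+a_{k+1}$, $L_{k+1}=2^{i_k}L_k$, and $\phi_{k+1}(x)=\phi_k(x)+a_{k+1}[f(x_{k+1})+\langle\nabla f(x_{k+1}),x-x_{k+1}\rangle+\Psi(x)]$. *)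

theory Defs
  imports "HOL-Analysis.Analysis"
begin

definition curvature_bound :: "('a::real_normed_vector \<Rightarrow> real) \<Rightarrow> real \<Rightarrow> ereal" where
  "curvature_bound f t =
     Sup {ereal ((\<alpha> * f x + (1 - \<alpha>) * f y - f (\<alpha> *\<^sub>R x + (1 - \<alpha>) *\<^sub>R y)) / (\<alpha> * (1 - \<alpha>)))
          | x y \<alpha>. 0 < \<alpha> \<and> \<alpha> < 1 \<and> norm (x - y) \<le> t}"

definition regular :: "('a::real_normed_vector \<Rightarrow> real) \<Rightarrow> bool" where
  "regular f \<longleftrightarrow>
     (\<forall>t\<ge>0. curvature_bound f t < \<infinity>) \<and>
     ((\<lambda>\<tau>. curvature_bound f \<tau> / ereal \<tau>) \<longlongrightarrow> 0) (at_right 0)"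

(* For regular, non-affine convex f the curvature bound is a continuous strictly increasing
   bijection of the half-lines [0,oo), so this is its genuine inverse there. *)
definition complexity_gauge :: "('a::real_normed_vector \<Rightarrow> real) \<Rightarrow> real \<Rightarrow> real" where
  "complexity_gauge f e = inv_into {0..} (curvature_bound f) (ereal e)"

definition gamma_gauge :: "('a::real_normed_vector \<Rightarrow> real) \<Rightarrow> real \<Rightarrow> real" where
  "gamma_gauge f t = t / (complexity_gauge f (t / 2))\<^sup>2"

definition bregman ::
  "('a::real_normed_vector \<Rightarrow> real) \<Rightarrow> ('a \<Rightarrow> 'a \<Rightarrow>\<^sub>L real) \<Rightarrow> 'a \<Rightarrow> 'a \<Rightarrow> real" where
  "bregman d gd x y = d y - d x - blinfun_apply (gd x) (y - x)"

(* The data available at the beginning of iteration k: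
   x_k, y_k, a_k, A_k, L_k and the estimating function phi_k. *)
record 'a ufgm_state =
  st_x :: 'a
  st_y :: 'a
  st_a :: real
  st_A :: real
  st_L :: real
  st_phi :: "'a \<Rightarrow> real"

(* Throughout, Q stands for dom Psi, the values of Psi and d outside Q being irrelevant;
   gf and gd are the (sub)gradient maps of f and d, with values in the dual space. *)
context
  fixes f :: "'a::real_normed_vector \<Rightarrow> real"
    and gf :: "'a \<Rightarrow> 'a \<Rightarrow>\<^sub>L real"
    and Q :: "'a set"
    and Psi :: "'a \<Rightarrow> real"
    and d :: "'a \<Rightarrow> real"
    and gd :: "'a \<Rightarrow> 'a \<Rightarrow>\<^sub>L real"
    and x0 :: 'a
    and L0 \<epsilon> :: real
begin

(* There is no a_0 in the method; the value 0 is a placeholder that is never read. *)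
definition ufgm_init :: "'a ufgm_state" where
  "ufgm_init = \<lparr>st_x = x0, st_y = x0, st_a = 0, st_A = 0, st_L = L0, st_phi = bregman d gd x0\<rparr>"

definition ufgm_coeff :: "'a ufgm_state \<Rightarrow> nat \<Rightarrow> real \<Rightarrow> bool" where
  "ufgm_coeff s i a \<longleftrightarrow> 0 < a \<and> a\<^sup>2 = 1 / (2 ^ i * st_L s) * (st_A s + a)"

definition ufgm_tau :: "'a ufgm_state \<Rightarrow> real \<Rightarrow> real" where
  "ufgm_tau s a = a / (st_A s + a)"

definition ufgm_x :: "'a ufgm_state \<Rightarrow> 'a \<Rightarrow> real \<Rightarrow> 'a" where
  "ufgm_x s v a = ufgm_tau s a *\<^sub>R v + (1 - ufgm_tau s a) *\<^sub>R st_y s"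

definition ufgm_aux :: "'a ufgm_state \<Rightarrow> 'a \<Rightarrow> real \<Rightarrow> 'a \<Rightarrow> real" where
  "ufgm_aux s v a z = bregman d gd v z + a * (blinfun_apply (gf (ufgm_x s v a)) z + Psi z)"

definition ufgm_y :: "'a ufgm_state \<Rightarrow> real \<Rightarrow> 'a \<Rightarrow> 'a" where
  "ufgm_y s a xhat = ufgm_tau s a *\<^sub>R xhat + (1 - ufgm_tau s a) *\<^sub>R st_y s"

(* The trial with index i, coefficient a and auxiliary minimizer xhat passes the test;
   the factor 2 ^ i / 2 is 2^(i-1). *)
definition ufgm_accepts :: "'a ufgm_state \<Rightarrow> 'a \<Rightarrow> nat \<Rightarrow> real \<Rightarrow> 'a \<Rightarrow> bool" where
  "ufgm_accepts s v i a xhat \<longleftrightarrow>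
     ufgm_coeff s i a \<and>
     is_arg_min (ufgm_aux s v a) (\<lambda>z. z \<in> Q) xhat \<and>
     (let x = ufgm_x s v a; y = ufgm_y s a xhat in
        f y \<le> f x + blinfun_apply (gf x) (y - x)
               + 2 ^ i / 2 * st_L s * (norm (y - x))\<^sup>2 + \<epsilon> / 2 * ufgm_tau s a)"

definition ufgm_step :: "'a ufgm_state \<Rightarrow> 'a ufgm_state \<Rightarrow> bool" where
  "ufgm_step s s' \<longleftrightarrow>
     (\<exists>v i a xhat.
        is_arg_min (st_phi s) (\<lambda>z. z \<in> Q) v \<and>
        ufgm_accepts s v i a xhat \<and>
        (\<forall>j<i. \<not> (\<exists>b z. ufgm_accepts s v j b z)) \<and>
        (let x = ufgm_x s v a in
          s' = \<lparr>st_x = x, st_y = ufgm_y s a xhat, st_a = a, st_A = st_A s + a,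
                st_L = 2 ^ i * st_L s,
                st_phi = (\<lambda>z. st_phi s z + a * (f x + blinfun_apply (gf x) (z - x) + Psi z))\<rparr>))"

definition ufgm_reachable :: "'a ufgm_state \<Rightarrow> bool" where
  "ufgm_reachable s \<longleftrightarrow> ufgm_step\<^sup>*\<^sup>* ufgm_init s"

definition ufgm_run :: "(nat \<Rightarrow> 'a ufgm_state) \<Rightarrow> bool" where
  "ufgm_run s \<longleftrightarrow> s 0 = ufgm_init \<and> (\<forall>k. ufgm_step (s k) (s (Suc k)))"

(* The minimization problems posed in an iteration started from s have solutions.
   Nothing is said here about termination of the search for i. *)
definition ufgm_solvable :: "'a ufgm_state \<Rightarrow> bool" where
  "ufgm_solvable s \<longleftrightarrow>
     (\<exists>v. is_arg_min (st_phi s) (\<lambda>z. z \<in> Q) v) \<and>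
     (\<forall>v i a. is_arg_min (st_phi s) (\<lambda>z. z \<in> Q) v \<longrightarrow> ufgm_coeff s i a \<longrightarrow>
        (\<exists>xhat. is_arg_min (ufgm_aux s v a) (\<lambda>z. z \<in> Q) xhat))"

end

end

theory Submission imports Defs begin

text \<open>
  The curvature bound \<open>\<mu>\<close> of a convex function satisfies
  \<open>\<mu>(c t) \<le> c\<^sup>2 \<mu>(t)\<close> for \<open>c \<ge> 1\<close> (lemma \<open>curv_scale\<close>). Together with monotonicity,
  the superlinear decay at 0 and the fact that the convex function \<open>f\<close> is not affine, this makes \<open>\<mu>\<close>
  continuous, positive and unbounded on the positive half-line, so that its inverse \<open>s\<^sub>f\<close> exists;
  it also makes \<open>\<gamma>\<^sub>f\<close> nonincreasing (\<open>gamma_gauge_antimono\<close>). The superlinear decay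
  forces \<open>f\<close> to be differentiable, so \<open>\<mu>(\<parallel>y - x\<parallel>)\<close> bounds the linearization error between
  \<open>x\<close> and \<open>y\<close>. Hence \<open>f\<close> lies below the quadratic model with
  constant \<open>M\<close> and tolerance \<open>e / 2\<close> whenever \<open>M \<ge> \<gamma>\<^sub>f(e)\<close>
  (\<open>inexact_quadratic_bound\<close>).

  The acceptance test of the method asks for this model with \<open>e = \<epsilon> \<tau>\<close> and
  \<open>M = 2\<^sup>i L\<^sub>k\<close>. It is passed for large \<open>i\<close>, since \<open>M\<close> eventually exceeds
  \<open>\<gamma>\<^sub>f(\<epsilon> \<tau>)\<close> although the latter may grow as \<open>\<tau>\<close> shrinks (\<open>line_search_threshold\<close>), so
  every iteration terminates. Its result is unique, because all minimization problems involve a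
  strongly convex objective. The last rejected index gives
  \<open>L \<le> 2 \<gamma>\<^sub>f(\<epsilon> \<tau>)\<close>; if none was rejected, the bound is inherited from the previous
  iteration by monotonicity of \<open>\<gamma>\<^sub>f\<close> and of the step ratios (\<open>step_preserves\<close>).

  The step ratio satisfies \<open>\<tau>\<^sup>2 L A = 1\<close> with the updated \<open>L\<close> and \<open>A\<close>. Both of
  them are nondecreasing, so \<open>\<tau>\<close> is nonincreasing; and the square root of \<open>L A\<close> grows by at
  least one half per iteration, which gives \<open>\<tau> \<le> 2 / (k + 1)\<close>. The estimate of
  \<open>A\<^sub>k (f(y\<^sub>k) + Psi(y\<^sub>k) - \<epsilon> / 2)\<close> by the minimum of the estimating function is
  the induction typical for estimating sequences; its step is \<open>estimate_step\<close>.
\<close>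

section \<open>The global curvature bound\<close>

text \<open>
  The extended-real curvature bound of a regular function only takes finite values on
  the half-line, so all estimates are made for its real-valued version.
\<close>
definition curv :: "('a::real_normed_vector \<Rightarrow> real) \<Rightarrow> real \<Rightarrow> real" where
  "curv f t = real_of_ereal (curvature_bound f t)"

lemma curvature_bound_eq_curv:
  assumes "regular f" "0 \<le> t"
  shows "curvature_bound f t = ereal (curv f t)"
    and "0 \<le> curv f t"
proof -
  have "0 \<le> curvature_bound f t"
    unfolding curvature_bound_def
  proof (rule Sup_upper, rule CollectI)
    show "\<exists>x y \<alpha>. (0::ereal) = ereal ((\<alpha> * f x + (1 - \<alpha>) * f y - f (\<alpha> *\<^sub>R x + (1 - \<alpha>) *\<^sub>R y))
              / (\<alpha> * (1 - \<alpha>))) \<and> 0 < \<alpha> \<and> \<alpha> < 1 \<and> norm (x - y) \<le> t"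
      using \<open>0 \<le> t\<close>
      by (intro exI[of _ 0] exI[of _ "1/2"]) (auto simp: zero_ereal_def)
  qed
  moreover have "curvature_bound f t < \<infinity>"
    using assms by (auto simp: regular_def)
  ultimately show "curvature_bound f t = ereal (curv f t)" "0 \<le> curv f t"
    unfolding curv_def by (cases "curvature_bound f t"; simp)+
qed

lemma chord_gap_le_curv:
  assumes "regular f" "norm (x - y) \<le> t" "0 < \<alpha>" "\<alpha> < 1"
  shows "\<alpha> * f x + (1 - \<alpha>) * f y - f (\<alpha> *\<^sub>R x + (1 - \<alpha>) *\<^sub>R y) \<le> \<alpha> * (1 - \<alpha>) * curv f t"
proof -
  have t: "0 \<le> t" using assms(2) norm_ge_zero order_trans by blast
  have "ereal ((\<alpha> * f x + (1 - \<alpha>) * f y - f (\<alpha> *\<^sub>R x + (1 - \<alpha>) *\<^sub>R y)) / (\<alpha> * (1 - \<alpha>)))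
          \<le> curvature_bound f t"
    unfolding curvature_bound_def using assms by (intro Sup_upper) blast
  then have "(\<alpha> * f x + (1 - \<alpha>) * f y - f (\<alpha> *\<^sub>R x + (1 - \<alpha>) *\<^sub>R y)) / (\<alpha> * (1 - \<alpha>)) \<le> curv f t"
    by (simp add: curvature_bound_eq_curv[OF assms(1) t])
  moreover have "0 < \<alpha> * (1 - \<alpha>)" using assms by simp
  ultimately show ?thesis by (simp add: pos_divide_le_eq mult.commute)
qed

lemma curv_leI:
  fixes f :: "'a::real_normed_vector \<Rightarrow> real"
  assumes "regular f" "0 \<le> t"
    and "\<And>x y \<alpha>. \<lbrakk>0 < \<alpha>; \<alpha> < 1; norm (x - y) \<le> t\<rbrakk> \<Longrightarrow>
      \<alpha> * f x + (1 - \<alpha>) * f y - f (\<alpha> *\<^sub>R x + (1 - \<alpha>) *\<^sub>R y) \<le> \<alpha> * (1 - \<alpha>) * M"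
  shows "curv f t \<le> M"
proof -
  have "curvature_bound f t \<le> ereal M"
    unfolding curvature_bound_def
  proof (rule Sup_least, clarify)
    fix x y :: 'a and \<alpha> :: real
    assume a: "0 < \<alpha>" "\<alpha> < 1" "norm (x - y) \<le> t"
    have "0 < \<alpha> * (1 - \<alpha>)" using a by simp
    with assms(3)[OF a]
    show "ereal ((\<alpha> * f x + (1 - \<alpha>) * f y - f (\<alpha> *\<^sub>R x + (1 - \<alpha>) *\<^sub>R y)) / (\<alpha> * (1 - \<alpha>))) \<le> ereal M"
      by (simp add: pos_divide_le_eq mult.commute)
  qed
  then show ?thesis by (simp add: curvature_bound_eq_curv[OF assms(1,2)])
qed

lemma curv_mono:
  assumes "regular f" "0 \<le> s" "s \<le> t"
  shows "curv f s \<le> curv f t"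
  using assms by (intro curv_leI chord_gap_le_curv) auto

lemma curv_zero:
  fixes f :: "'a::real_normed_vector \<Rightarrow> real"
  assumes "regular f"
  shows "curv f 0 = 0"
proof (rule antisym)
  show "curv f 0 \<le> 0"
  proof (rule curv_leI[OF assms])
    fix x y :: 'a and \<alpha> :: real
    assume "norm (x - y) \<le> 0"
    then have "x = y" by simp
    then show "\<alpha> * f x + (1 - \<alpha>) * f y - f (\<alpha> *\<^sub>R x + (1 - \<alpha>) *\<^sub>R y) \<le> \<alpha> * (1 - \<alpha>) * 0"
      by (simp add: algebra_simps)
  qed simp
qed (use curvature_bound_eq_curv(2)[OF assms] in simp)

lemma curv_sublinear_at_0:
  assumes "regular f" "0 < K"
  obtains r where "0 < r" "\<And>t. \<lbrakk>0 \<le> t; t \<le> r\<rbrakk> \<Longrightarrow> curv f t \<le> K * t"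
proof -
  have "\<forall>\<^sub>F t in at_right 0. curvature_bound f t / ereal t < ereal K"
    using assms by (intro order_tendstoD(2)[of _ 0]) (auto simp: regular_def)
  then obtain b where b: "0 < b" "\<And>t. \<lbrakk>0 < t; t < b\<rbrakk> \<Longrightarrow> curvature_bound f t / ereal t < ereal K"
    by (auto simp: eventually_at_right[of 0 1])
  have "curv f t \<le> K * t" if t: "0 \<le> t" "t \<le> b / 2" for t
  proof (cases "t = 0")
    case False
    then have "0 < t" "t < b" using t b(1) by auto
    then have "ereal (curv f t / t) < ereal K"
      using b(2)[of t] by (simp add: curvature_bound_eq_curv(1)[OF assms(1)])
    then show ?thesis using \<open>0 < t\<close> by (simp add: pos_divide_less_eq)
  qed (simp add: curv_zero assms)
  then show thesis using b(1) by (intro that[of "b / 2"]) auto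
qed

text \<open>
  If the gap between chord and graph is controlled by the quadratic function
  \<open>M * \<theta>\<^sup>2\<close> on all subintervals of one fixed length \<open>h\<close>, then it is so controlled on
  the whole unit interval. Subtract from \<open>\<phi>\<close> its chord over \<open>[0,1]\<close> and add the
  parabola \<open>w * (1 - w) * M\<close>. The result \<open>\<psi>\<close> lies above its chord on every
  subinterval of length \<open>h\<close>, so at an interior minimizer the left endpoint of such
  a subinterval would be a minimizer as well. Hence the leftmost minimizer is an endpoint
  of \<open>[0,1]\<close>, where \<open>\<psi>\<close> vanishes, and \<open>\<psi>\<close> is nonnegative.
\<close>
lemma chord_gap_from_fixed_length:
  fixes \<phi> :: "real \<Rightarrow> real"
  assumes cont: "continuous_on {0..1} \<phi>" and h: "0 < h" "h < 1"
    and gap: "\<And>u \<alpha>. \<lbrakk>0 \<le> u; u + h \<le> 1; 0 < \<alpha>; \<alpha> < 1\<rbrakk> \<Longrightarrow>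
      \<alpha> * \<phi> (u + h) + (1 - \<alpha>) * \<phi> u - \<phi> (u + \<alpha> * h) \<le> \<alpha> * (1 - \<alpha>) * (M * h\<^sup>2)"
    and \<alpha>: "0 \<le> \<alpha>" "\<alpha> \<le> 1"
  shows "\<alpha> * \<phi> 1 + (1 - \<alpha>) * \<phi> 0 - \<phi> \<alpha> \<le> \<alpha> * (1 - \<alpha>) * M"
proof -
  define \<psi> where "\<psi> w = \<phi> w - (w * \<phi> 1 + (1 - w) * \<phi> 0) + w * (1 - w) * M" for w
  have \<psi>01: "\<psi> 0 = 0" "\<psi> 1 = 0" by (auto simp: \<psi>_def)
  have \<psi>_gap: "\<beta> * \<psi> (u + h) + (1 - \<beta>) * \<psi> u \<le> \<psi> (u + \<beta> * h)"
    if "0 \<le> u" "u + h \<le> 1" "0 < \<beta>" "\<beta> < 1" for u \<beta>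
    using gap[OF that] unfolding \<psi>_def by (simp add: algebra_simps power2_eq_square)
  have cont_\<psi>: "continuous_on {0..1} \<psi>"
    unfolding \<psi>_def by (intro continuous_intros cont)
  obtain p where p: "p \<in> {0..1}" "\<And>w. w \<in> {0..1} \<Longrightarrow> \<psi> p \<le> \<psi> w"
    using continuous_attains_inf[OF compact_Icc _ cont_\<psi>] by auto
  define S where "S = {w \<in> {0..1}. \<psi> w = \<psi> p}"
  have "compact S"
  proof -
    have "closed S"
      unfolding S_def by (rule continuous_closed_preimage_constant[OF cont_\<psi> closed_atLeastAtMost])
    moreover have "bounded S" unfolding S_def by (rule bounded_subset[OF bounded_closed_interval[of 0 1]]) auto
    ultimately show ?thesis by (simp add: compact_eq_bounded_closed)
  qed
  moreover have "S \<noteq> {}" using p(1) by (auto simp: S_def)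
  ultimately obtain q where q: "q \<in> S" "\<And>w. w \<in> S \<Longrightarrow> q \<le> w"
    using compact_attains_inf by meson
  have q01: "0 \<le> q" "q \<le> 1" "\<psi> q = \<psi> p" using q(1) by (auto simp: S_def)
  have "q = 0 \<or> q = 1"
  proof (rule ccontr)
    assume "\<not> ?thesis"
    then have q': "0 < q" "q < 1" using q01 by auto
    \<comment> \<open>This choice puts \<open>q\<close> at the fraction \<open>q\<close> of the subinterval \<open>[u, u + h]\<close>, which
      stays inside the unit interval.\<close>
    define u where "u = q * (1 - h)"
    have u: "0 \<le> u" "u + h \<le> 1" "u < q" "u + q * h = q"
    proof -
      have "0 < q * h" "0 < (1 - q) * (1 - h)" "0 \<le> q * (1 - h)" using q' h by auto
      then show "0 \<le> u" "u + h \<le> 1" "u < q" "u + q * h = q"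
        by (auto simp: u_def algebra_simps)
    qed
    have "q * \<psi> (u + h) + (1 - q) * \<psi> u \<le> \<psi> p"
      using \<psi>_gap[OF u(1,2) q'] u(4) q01(3) by simp
    moreover have "q * \<psi> p \<le> q * \<psi> (u + h)"
      using q' u h by (intro mult_left_mono p(2)) auto
    ultimately have "(1 - q) * \<psi> u \<le> (1 - q) * \<psi> p" by (simp add: algebra_simps)
    then have "\<psi> u \<le> \<psi> p" using q' by simp
    then have "u \<in> S" using p(2)[of u] u h by (auto simp: S_def)
    then show False using q(2) u(3) by force
  qed
  then have "\<psi> p = 0" using q01(3) \<psi>01 by metis
  then have "0 \<le> \<psi> \<alpha>" using p(2)[of \<alpha>] \<alpha> by simp
  then show ?thesis by (simp add: \<psi>_def)
qed

lemma convex_on_continuous_on_line: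
  fixes f :: "'a::real_normed_vector \<Rightarrow> real"
  assumes "convex_on UNIV f"
  shows "continuous_on UNIV (\<lambda>\<theta>::real. f (y + \<theta> *\<^sub>R h))"
proof (rule convex_on_continuous)
  show "convex_on UNIV (\<lambda>\<theta>::real. f (y + \<theta> *\<^sub>R h))"
  proof (rule convex_onI)
    fix t u v :: real
    assume "0 < t" "t < 1"
    then have "f ((1 - t) *\<^sub>R (y + u *\<^sub>R h) + t *\<^sub>R (y + v *\<^sub>R h))
        \<le> (1 - t) * f (y + u *\<^sub>R h) + t * f (y + v *\<^sub>R h)"
      by (intro convex_onD[OF assms]) auto
    moreover have "(1 - t) *\<^sub>R (y + u *\<^sub>R h) + t *\<^sub>R (y + v *\<^sub>R h)
        = y + ((1 - t) *\<^sub>R u + t *\<^sub>R v) *\<^sub>R h"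
      by (simp add: algebra_simps)
    ultimately show "f (y + ((1 - t) *\<^sub>R u + t *\<^sub>R v) *\<^sub>R h)
        \<le> (1 - t) * f (y + u *\<^sub>R h) + t * f (y + v *\<^sub>R h)"
      by simp
  qed simp
qed simp

text \<open>
  The curvature bound grows at most quadratically: a segment of length \<open>c * t\<close>,
  rescaled to the unit interval, has subintervals of length \<open>1 / c\<close> that correspond to
  segments of length \<open>t\<close>. Equivalently, the bound divided by the square of its argument
  is nonincreasing, which is where the monotonicity of \<open>\<gamma>\<^sub>f\<close> and the
  inexact quadratic upper model come from.
\<close>
lemma curv_scale:
  fixes f :: "'a::real_normed_vector \<Rightarrow> real"
  assumes "regular f" "convex_on UNIV f" "1 \<le> c" "0 \<le> t"
  shows "curv f (c * t) \<le> c\<^sup>2 * curv f t"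
proof (cases "c = 1")
  case False
  then have c: "1 < c" using assms(3) by simp
  show ?thesis
  proof (rule curv_leI[OF assms(1)])
    fix x y :: 'a and \<alpha> :: real
    assume \<alpha>: "0 < \<alpha>" "\<alpha> < 1" and xy: "norm (x - y) \<le> c * t"
    define \<phi> where "\<phi> \<theta> = f (y + \<theta> *\<^sub>R (x - y))" for \<theta>
    have "\<alpha> * \<phi> 1 + (1 - \<alpha>) * \<phi> 0 - \<phi> \<alpha> \<le> \<alpha> * (1 - \<alpha>) * (c\<^sup>2 * curv f t)"
    proof (rule chord_gap_from_fixed_length[where h = "1 / c"])
      show "continuous_on {0..1} \<phi>"
        unfolding \<phi>_def
        using convex_on_continuous_on_line[OF assms(2)] continuous_on_subset by blast
      show "\<beta> * \<phi> (u + 1 / c) + (1 - \<beta>) * \<phi> u - \<phi> (u + \<beta> * (1 / c))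
          \<le> \<beta> * (1 - \<beta>) * (c\<^sup>2 * curv f t * (1 / c)\<^sup>2)"
        if "0 < \<beta>" "\<beta> < 1" for u \<beta>
      proof -
        have "(y + (u + 1 / c) *\<^sub>R (x - y)) - (y + u *\<^sub>R (x - y)) = (1 / c) *\<^sub>R (x - y)"
          by (simp add: algebra_simps)
        then have "norm ((y + (u + 1 / c) *\<^sub>R (x - y)) - (y + u *\<^sub>R (x - y))) \<le> t"
          using xy c by (simp add: pos_divide_le_eq mult.commute)
        from chord_gap_le_curv[OF assms(1) this that]
        have "\<beta> * \<phi> (u + 1 / c) + (1 - \<beta>) * \<phi> u -
            f (\<beta> *\<^sub>R (y + (u + 1 / c) *\<^sub>R (x - y)) + (1 - \<beta>) *\<^sub>R (y + u *\<^sub>R (x - y)))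
            \<le> \<beta> * (1 - \<beta>) * curv f t"
          by (simp add: \<phi>_def)
        moreover have "\<beta> *\<^sub>R (y + (u + 1 / c) *\<^sub>R (x - y)) + (1 - \<beta>) *\<^sub>R (y + u *\<^sub>R (x - y))
            = y + (u + \<beta> * (1 / c)) *\<^sub>R (x - y)"
          by (simp add: algebra_simps)
        ultimately show ?thesis using c by (simp add: \<phi>_def power_divide)
      qed
    qed (use c \<alpha> in auto)
    moreover have "y + \<alpha> *\<^sub>R (x - y) = \<alpha> *\<^sub>R x + (1 - \<alpha>) *\<^sub>R y" by (simp add: algebra_simps)
    ultimately show "\<alpha> * f x + (1 - \<alpha>) * f y - f (\<alpha> *\<^sub>R x + (1 - \<alpha>) *\<^sub>R y)
        \<le> \<alpha> * (1 - \<alpha>) * (c\<^sup>2 * curv f t)"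
      by (simp add: \<phi>_def)
  qed (use assms in auto)
qed simp

lemma curv_scale_quotient:
  assumes "regular f" "convex_on UNIV f" "0 < s" "s \<le> t"
  shows "curv f t \<le> (t / s)\<^sup>2 * curv f s"
  using curv_scale[OF assms(1,2), of "t / s" s] assms(3,4) by simp

text \<open>
  Monotonicity and at most quadratic growth squeeze the values near \<open>t\<close> between
  multiples of the value at \<open>t\<close> whose factors tend to 1.
\<close>
lemma curv_continuous_on:
  fixes f :: "'a::real_normed_vector \<Rightarrow> real"
  assumes reg: "regular f" and conv: "convex_on UNIV f"
  shows "continuous_on {0<..} (curv f)"
proof (rule continuous_at_imp_continuous_on, rule ballI)
  fix t :: real
  assume "t \<in> {0<..}"
  then have t: "0 < t" by simp
  have ev: "\<forall>\<^sub>F u in at t. 0 < u" using order_tendstoD(1)[OF tendsto_ident_at t] .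
  have pos: "0 \<le> curv f t" using curvature_bound_eq_curv(2)[OF reg, of t] t by simp
  have lower: "min 1 ((u / t)\<^sup>2) * curv f t \<le> curv f u" if u: "0 < u" for u
  proof (cases "u \<le> t")
    case True
    have "min 1 ((u / t)\<^sup>2) * curv f t \<le> (u / t)\<^sup>2 * curv f t"
      by (rule mult_right_mono[OF _ pos]) simp
    also have "\<dots> \<le> (u / t)\<^sup>2 * ((t / u)\<^sup>2 * curv f u)"
      using curv_scale_quotient[OF reg conv u True] by (intro mult_left_mono) auto
    also have "\<dots> = curv f u" using u t by (simp add: power_divide)
    finally show ?thesis .
  next
    case False
    have "min 1 ((u / t)\<^sup>2) * curv f t \<le> 1 * curv f t"
      by (rule mult_right_mono[OF _ pos]) simp
    also have "\<dots> \<le> curv f u" using t False curv_mono[OF reg, of t u] by simp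
    finally show ?thesis .
  qed
  have upper: "curv f u \<le> max 1 ((u / t)\<^sup>2) * curv f t" if u: "0 < u" for u
  proof (cases "u \<le> t")
    case True
    then have "curv f u \<le> 1 * curv f t" using u curv_mono[OF reg, of u t] by simp
    also have "\<dots> \<le> max 1 ((u / t)\<^sup>2) * curv f t"
      by (rule mult_right_mono[OF _ pos]) simp
    finally show ?thesis .
  next
    case False
    then have "curv f u \<le> (u / t)\<^sup>2 * curv f t" using t by (intro curv_scale_quotient[OF reg conv]) auto
    also have "\<dots> \<le> max 1 ((u / t)\<^sup>2) * curv f t"
      by (rule mult_right_mono[OF _ pos]) simp
    finally show ?thesis .
  qed
  have "(curv f \<longlongrightarrow> curv f t) (at t)"
  proof (rule tendsto_sandwich)
    show "\<forall>\<^sub>F u in at t. min 1 ((u / t)\<^sup>2) * curv f t \<le> curv f u"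
      using ev by eventually_elim (rule lower)
    show "\<forall>\<^sub>F u in at t. curv f u \<le> max 1 ((u / t)\<^sup>2) * curv f t"
      using ev by eventually_elim (rule upper)
    have "((\<lambda>u. min 1 ((u / t)\<^sup>2) * curv f t) \<longlongrightarrow> min 1 ((t / t)\<^sup>2) * curv f t) (at t)"
      using t by (intro tendsto_intros) auto
    then show "((\<lambda>u. min 1 ((u / t)\<^sup>2) * curv f t) \<longlongrightarrow> curv f t) (at t)" using t by simp
    have "((\<lambda>u. max 1 ((u / t)\<^sup>2) * curv f t) \<longlongrightarrow> max 1 ((t / t)\<^sup>2) * curv f t) (at t)"
      using t by (intro tendsto_intros) auto
    then show "((\<lambda>u. max 1 ((u / t)\<^sup>2) * curv f t) \<longlongrightarrow> curv f t) (at t)" using t by simp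
  qed
  then show "isCont (curv f) t" by (simp add: isCont_def)
qed

section \<open>Linearization error and the complexity gauge\<close>

locale regular_convex =
  fixes f :: "'a::real_normed_vector \<Rightarrow> real"
    and gf :: "'a \<Rightarrow> 'a \<Rightarrow>\<^sub>L real"
  assumes reg: "regular f"
    and conv: "convex_on UNIV f"
    and not_affine: "\<not> (\<exists>(g :: 'a \<Rightarrow>\<^sub>L real) c. \<forall>x. f x = blinfun_apply g x + c)"
    and subgradient: "f y \<ge> f x + blinfun_apply (gf x) (y - x)"
begin

text \<open>
  Comparing the chord from \<open>x\<close> to \<open>y\<close> with the graph at a point close to \<open>x\<close>
  bounds the linearization error with the directional derivative in place of the
  subgradient. The superlinear decay of the curvature bound at 0 makes these two agree:
  it forces the second difference of \<open>f\<close> at \<open>x\<close> to be of smaller order than the step, so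
  that the subgradient inequality in the direction \<open>- h\<close> yields an upper estimate in the
  direction \<open>h\<close>.
\<close>
lemma linearization_error_le_curv:
  shows "f y \<le> f x + blinfun_apply (gf x) (y - x) + curv f (norm (y - x))"
proof (cases "y = x")
  case False
  define h where "h = y - x"
  have h: "0 < norm h" using False by (simp add: h_def)
  show ?thesis
  proof (rule field_le_epsilon)
    fix e :: real
    assume "0 < e"
    obtain r where r: "0 < r" "\<And>t. \<lbrakk>0 \<le> t; t \<le> r\<rbrakk> \<Longrightarrow> curv f t \<le> (e / norm h) * t"
      using curv_sublinear_at_0[OF reg, of "e / norm h"] h \<open>0 < e\<close> by auto
    \<comment> \<open>The points \<open>x + \<delta> h\<close> and \<open>x - \<delta> h\<close> must be at most \<open>r\<close> apart.\<close>
    define \<delta> where "\<delta> = min (1 / 2) (r / (2 * norm h))"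
    have \<delta>: "0 < \<delta>" "\<delta> < 1" "2 * \<delta> * norm h \<le> r"
    proof -
      show "0 < \<delta>" "\<delta> < 1" using r(1) h by (auto simp: \<delta>_def)
      have "2 * \<delta> * norm h \<le> 2 * (r / (2 * norm h)) * norm h"
        unfolding \<delta>_def using h by (intro mult_right_mono mult_left_mono) auto
      then show "2 * \<delta> * norm h \<le> r" using h by simp
    qed
    have "norm ((x + \<delta> *\<^sub>R h) - (x - \<delta> *\<^sub>R h)) = 2 * \<delta> * norm h"
      using \<delta>(1) by (simp add: scaleR_2[symmetric] del: scaleR_scaleR)
    then have "norm ((x + \<delta> *\<^sub>R h) - (x - \<delta> *\<^sub>R h)) \<le> 2 * \<delta> * norm h" by simp
    from chord_gap_le_curv[OF reg this, of "1 / 2"]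
    have "1 / 2 * f (x + \<delta> *\<^sub>R h) + 1 / 2 * f (x - \<delta> *\<^sub>R h)
          - f ((1 / 2) *\<^sub>R (x + \<delta> *\<^sub>R h) + (1 / 2) *\<^sub>R (x - \<delta> *\<^sub>R h)) \<le> 1 / 4 * curv f (2 * \<delta> * norm h)"
      by simp
    moreover have "(1 / 2) *\<^sub>R (x + \<delta> *\<^sub>R h) + (1 / 2) *\<^sub>R (x - \<delta> *\<^sub>R h) = x"
      by (simp add: algebra_simps flip: scaleR_add_left)
    moreover have "curv f (2 * \<delta> * norm h) \<le> (e / norm h) * (2 * \<delta> * norm h)"
      using \<delta> by (intro r(2)) auto
    moreover have "(e / norm h) * (2 * \<delta> * norm h) = 2 * \<delta> * e" using h by simp
    moreover have "f (x - \<delta> *\<^sub>R h) \<ge> f x - \<delta> * blinfun_apply (gf x) h"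
      using subgradient[of x "x - \<delta> *\<^sub>R h"] by (simp add: blinfun.bilinear_simps)
    ultimately have dirderiv: "f (x + \<delta> *\<^sub>R h) \<le> f x + \<delta> * blinfun_apply (gf x) h + \<delta> * e"
      by simp
    have "norm (y - x) \<le> norm h" by (simp add: h_def)
    from chord_gap_le_curv[OF reg this \<delta>(1,2)]
    have "\<delta> * f y + (1 - \<delta>) * f x - f (x + \<delta> *\<^sub>R h) \<le> \<delta> * (1 - \<delta>) * curv f (norm h)"
      by (simp add: h_def algebra_simps)
    also have "\<dots> \<le> \<delta> * curv f (norm h)"
      using \<delta> curvature_bound_eq_curv(2)[OF reg, of "norm h"] by (simp add: mult_left_le_one_le mult_right_le_one_le)
    finally have "\<delta> * f y \<le> \<delta> * (f x + blinfun_apply (gf x) h + curv f (norm h) + e)"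
      using dirderiv by (simp add: algebra_simps)
    then have "f y \<le> f x + blinfun_apply (gf x) h + curv f (norm h) + e"
      using \<delta>(1) by simp
    then show "f y \<le> f x + blinfun_apply (gf x) (y - x) + curv f (norm (y - x)) + e"
      by (simp add: h_def)
  qed
qed (simp add: blinfun.bilinear_simps curv_zero[OF reg])

lemma non_affine_linearization_error:
  obtains y where "f y > f 0 + blinfun_apply (gf 0) y"
proof -
  have "\<not> (\<forall>y. f y = blinfun_apply (gf 0) y + f 0)" using not_affine by blast
  then obtain y where "f y \<noteq> blinfun_apply (gf 0) y + f 0" by blast
  then have "f y > f 0 + blinfun_apply (gf 0) y" using subgradient[of 0 y] by simp
  then show thesis by (rule that)
qed

text \<open>
  A zero of the curvature bound at a positive argument spreads to the whole half-line by
  the quadratic growth bound, and then \<open>f\<close> coincides with its linearization at 0.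
\<close>
lemma curv_pos:
  assumes t: "0 < t"
  shows "0 < curv f t"
proof (rule ccontr)
  assume "\<not> ?thesis"
  then have 0: "curv f t = 0" using curvature_bound_eq_curv(2)[OF reg, of t] t by simp
  obtain y where y: "f y > f 0 + blinfun_apply (gf 0) y"
    using non_affine_linearization_error .
  have "curv f (norm y) \<le> 0"
    using curv_mono[OF reg, of "norm y" t] curv_scale_quotient[OF reg conv t, of "norm y"] 0
    by (cases "norm y \<le> t") auto
  then show False using linearization_error_le_curv[of y 0] y by simp
qed

text \<open>
  Along a ray from 0 on which \<open>f\<close> exceeds its linearization, convexity makes the excess
  grow at least linearly, and the curvature bound dominates this excess.
\<close>
lemma curv_unbounded:
  obtains t where "0 \<le> t" "M \<le> curv f t"
proof -
  obtain y where y: "f y > f 0 + blinfun_apply (gf 0) y"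
    using non_affine_linearization_error .
  define r where "r = f y - f 0 - blinfun_apply (gf 0) y"
  define c where "c = max 1 (M / r)"
  have r: "0 < r" using y by (simp add: r_def)
  have "1 \<le> c" "M / r \<le> c" by (auto simp: c_def)
  then have c: "1 \<le> c" "M \<le> c * r" using r by (auto simp: pos_divide_le_eq)
  have "f ((1 - 1 / c) *\<^sub>R 0 + (1 / c) *\<^sub>R (c *\<^sub>R y)) \<le> (1 - 1 / c) * f 0 + (1 / c) * f (c *\<^sub>R y)"
    using c by (intro convex_onD[OF conv]) auto
  then have "c * f y \<le> c * ((1 - 1 / c) * f 0 + (1 / c) * f (c *\<^sub>R y))"
    using c by (intro mult_left_mono) auto
  also have "\<dots> = (c - 1) * f 0 + f (c *\<^sub>R y)"
    using c by (simp add: field_simps)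
  finally have "c * r \<le> f (c *\<^sub>R y) - f 0 - blinfun_apply (gf 0) (c *\<^sub>R y)"
    by (simp add: r_def algebra_simps blinfun.bilinear_simps)
  also have "\<dots> \<le> curv f (norm (c *\<^sub>R y))"
    using linearization_error_le_curv[of "c *\<^sub>R y" 0] by simp
  finally show thesis using c(2) by (intro that[of "norm (c *\<^sub>R y)"]) auto
qed

text \<open>
  By the intermediate value theorem every positive number is a value of the curvature
  bound, so the inverse that defines the gauge is a genuine preimage.
\<close>
lemma complexity_gauge:
  assumes e: "0 < e"
  shows "0 < complexity_gauge f e" and "curv f (complexity_gauge f e) = e"
proof -
  obtain r where r: "0 < r" "\<And>t. \<lbrakk>0 \<le> t; t \<le> r\<rbrakk> \<Longrightarrow> curv f t \<le> 1 * t"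
    using curv_sublinear_at_0[OF reg, of 1] by auto
  define a where "a = min r e"
  have a: "0 < a" "curv f a \<le> e" using r(2)[of a] r(1) e by (auto simp: a_def)
  obtain b where b: "0 \<le> b" "e \<le> curv f b" using curv_unbounded .
  have "\<exists>t\<ge>a. t \<le> max a b \<and> curv f t = e"
  proof (rule IVT')
    show "e \<le> curv f (max a b)" using curv_mono[OF reg b(1), of "max a b"] b(2) by simp
    show "continuous_on {a..max a b} (curv f)"
      using a(1) by (intro continuous_on_subset[OF curv_continuous_on[OF reg conv]]) auto
  qed (use a in auto)
  then obtain t where "a \<le> t" "curv f t = e" by blast
  then have "0 \<le> t" "curv f t = e" using a(1) by auto
  then have "ereal e \<in> curvature_bound f ` {0..}"
    using curvature_bound_eq_curv(1)[OF reg] by force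
  from inv_into_into[OF this] f_inv_into_f[OF this]
  have s: "0 \<le> complexity_gauge f e" "curvature_bound f (complexity_gauge f e) = ereal e"
    by (simp_all add: complexity_gauge_def)
  then show "curv f (complexity_gauge f e) = e" by (simp add: curv_def)
  then have "complexity_gauge f e \<noteq> 0" using curv_zero[OF reg] e by force
  with s(1) show "0 < complexity_gauge f e" by simp
qed

lemma complexity_gauge_lessI:
  assumes e: "0 < e" and t: "0 \<le> t" "e < curv f t"
  shows "complexity_gauge f e < t"
  using curv_mono[OF reg t(1), of "complexity_gauge f e"] complexity_gauge(2)[OF e] t(2)
  by force

text \<open>
  With \<open>s\<close> the gauge at \<open>e / 2\<close>, the value of \<open>\<gamma>\<^sub>f\<close> at \<open>e\<close> is twice
  the curvature bound at \<open>s\<close> divided by \<open>s\<^sup>2\<close>; this quotient is nonincreasing in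
  \<open>s\<close>, and \<open>s\<close> increases with \<open>e\<close>.
\<close>
lemma gamma_gauge_antimono:
  assumes e: "0 < e1" "e1 \<le> e2"
  shows "gamma_gauge f e2 \<le> gamma_gauge f e1"
proof (cases "e1 = e2")
  case False
  define s1 s2 where "s1 = complexity_gauge f (e1 / 2)" and "s2 = complexity_gauge f (e2 / 2)"
  have e': "0 < e1 / 2" "0 < e2 / 2" using e by auto
  note s1 = complexity_gauge[OF e'(1), folded s1_def]
  note s2 = complexity_gauge[OF e'(2), folded s2_def]
  have "s1 < s2"
    unfolding s1_def
    using e False s2 by (intro complexity_gauge_lessI) auto
  then have "e2 / 2 \<le> (s2 / s1)\<^sup>2 * (e1 / 2)"
    using curv_scale_quotient[OF reg conv s1(1), of s2] s1(2) s2(2) by simp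
  then show ?thesis
    using s1(1) s2(1) by (simp add: gamma_gauge_def s1_def[symmetric] s2_def[symmetric] field_simps)
qed simp

text \<open>
  The upper model tested by the line search. Up to the distance \<open>s\<close> at which the curvature
  bound equals \<open>e / 2\<close>, the linearization error is absorbed by the constant \<open>e / 2\<close>; beyond
  it, quadratic growth from the value at \<open>s\<close> absorbs it in the quadratic term.
\<close>
lemma inexact_quadratic_bound:
  assumes e: "0 < e" and M: "gamma_gauge f e \<le> M"
  shows "f y \<le> f x + blinfun_apply (gf x) (y - x) + M / 2 * (norm (y - x))\<^sup>2 + e / 2"
proof -
  define s where "s = complexity_gauge f (e / 2)"
  have "0 < e / 2" using e by simp
  note s = complexity_gauge[OF this, folded s_def]
  have \<gamma>: "gamma_gauge f e = e / s\<^sup>2" by (simp add: gamma_gauge_def s_def)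
  have "curv f (norm (y - x)) \<le> gamma_gauge f e / 2 * (norm (y - x))\<^sup>2 + e / 2"
  proof (cases "norm (y - x) \<le> s")
    case True
    then have "curv f (norm (y - x)) \<le> e / 2" using curv_mono[OF reg, of "norm (y - x)" s] s by simp
    moreover have "0 \<le> gamma_gauge f e / 2 * (norm (y - x))\<^sup>2" using e by (simp add: \<gamma>)
    ultimately show ?thesis by simp
  next
    case False
    then have "curv f (norm (y - x)) \<le> (norm (y - x) / s)\<^sup>2 * (e / 2)"
      using curv_scale_quotient[OF reg conv s(1), of "norm (y - x)"] s(2) by simp
    also have "\<dots> = gamma_gauge f e / 2 * (norm (y - x))\<^sup>2" by (simp add: \<gamma> power_divide)
    finally show ?thesis using e by simp
  qed
  also have "\<dots> \<le> M / 2 * (norm (y - x))\<^sup>2 + e / 2"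
    using M by (intro add_right_mono mult_right_mono) auto
  finally show ?thesis using linearization_error_le_curv[of y x] by simp
qed

end

section \<open>The distance-generating function on the whole domain\<close>

lemma convex_shrink_into_interior:
  fixes Q :: "'a::real_normed_vector set"
  assumes "convex Q" "w \<in> interior Q" "x \<in> Q" "0 < t" "t \<le> 1"
  shows "x + t *\<^sub>R (w - x) \<in> interior Q"
proof -
  let ?S = "(\<lambda>z. (1 - t) *\<^sub>R x + t *\<^sub>R z) ` interior Q"
  have "open ?S" using assms(4) by (intro open_affinity) auto
  moreover have "?S \<subseteq> Q"
    using assms interior_subset[of Q] by (auto intro!: convexD)
  ultimately have "?S \<subseteq> interior Q" by (rule interior_maximal[rotated])
  moreover have "x + t *\<^sub>R (w - x) = (1 - t) *\<^sub>R x + t *\<^sub>R w" by (simp add: algebra_simps)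
  ultimately show ?thesis using assms(2) by auto
qed

lemma directional_difference_quotient:
  fixes d :: "'a::real_normed_vector \<Rightarrow> real" and D :: "'a \<Rightarrow>\<^sub>L real"
  assumes "(d has_derivative blinfun_apply D) (at v within Q)" "convex Q" "v \<in> Q" "x \<in> Q"
  shows "((\<lambda>t. (d (v + t *\<^sub>R (x - v)) - d v) / t) \<longlongrightarrow> blinfun_apply D (x - v)) (at_right 0)"
proof -
  let ?p = "\<lambda>t::real. v + t *\<^sub>R (x - v)"
  have "?p t \<in> Q" if "0 \<le> t" "t \<le> 1" for t
  proof -
    have "?p t = (1 - t) *\<^sub>R v + t *\<^sub>R x" by (simp add: algebra_simps)
    then show ?thesis using that assms(2-4) by (simp add: convexD_alt)
  qed
  then have "?p ` {0..1} \<subseteq> Q" by auto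
  then have "(d has_derivative blinfun_apply D) (at (?p 0) within ?p ` {0..1})"
    using has_derivative_subset[OF assms(1)] by simp
  moreover have "(?p has_derivative (\<lambda>t. t *\<^sub>R (x - v))) (at 0 within {0..1})"
    by (auto intro!: derivative_eq_intros)
  ultimately have "((\<lambda>t. d (?p t)) has_derivative (\<lambda>t. blinfun_apply D (t *\<^sub>R (x - v)))) (at 0 within {0..1})"
    by (rule has_derivative_in_compose[rotated])
  moreover have "(\<lambda>t::real. blinfun_apply D (t *\<^sub>R (x - v))) = (*) (blinfun_apply D (x - v))"
    by (simp add: fun_eq_iff blinfun.bilinear_simps)
  ultimately have "((\<lambda>t. d (?p t)) has_field_derivative blinfun_apply D (x - v)) (at 0 within {0..1})"
    by (simp add: has_field_derivative_def)
  then show ?thesis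
    by (simp add: has_field_derivative_iff at_within_Icc_at_right)
qed

locale prox_domain =
  fixes Q :: "'a::real_normed_vector set"
    and Psi :: "'a \<Rightarrow> real"
    and d :: "'a \<Rightarrow> real"
    and gd :: "'a \<Rightarrow> 'a \<Rightarrow>\<^sub>L real"
  assumes Psi_convex: "convex_on Q Psi"
    and interior_dom: "interior Q \<noteq> {}"
    and d_convex: "convex_on Q d"
    and d_differentiable: "x \<in> Q \<Longrightarrow> (d has_derivative blinfun_apply (gd x)) (at x within Q)"
    and d_strong: "x \<in> interior Q \<Longrightarrow> y \<in> Q \<Longrightarrow>
          d y \<ge> d x + blinfun_apply (gd x) (y - x) + 1 / 2 * (norm (y - x))\<^sup>2"
begin

lemma convex_dom: "convex Q"
  using d_convex by (rule convex_on_imp_convex)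

text \<open>
  At an interior point of a segment the strong convexity inequality towards both endpoints is
  available, and the gradient terms cancel in the convex combination.
\<close>
lemma d_strong_chord:
  assumes p: "v + t *\<^sub>R (x - v) \<in> interior Q" and "v \<in> Q" "x \<in> Q" "0 \<le> t" "t \<le> 1"
  shows "d (v + t *\<^sub>R (x - v)) + 1 / 2 * t * (1 - t) * (norm (x - v))\<^sup>2 \<le> (1 - t) * d v + t * d x"
proof -
  let ?p = "v + t *\<^sub>R (x - v)"
  let ?g = "blinfun_apply (gd ?p) (x - v)"
  let ?n = "norm (x - v)"
  have v: "v - ?p = - (t *\<^sub>R (x - v))" by simp
  have x: "x - ?p = (1 - t) *\<^sub>R (x - v)" by (simp add: algebra_simps)
  have "d v \<ge> d ?p - t * ?g + 1 / 2 * (t * ?n)\<^sup>2"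
    using d_strong[OF p \<open>v \<in> Q\<close>] assms(4) unfolding v by (simp add: blinfun.bilinear_simps)
  then have 1: "(1 - t) * (d ?p - t * ?g + 1 / 2 * (t * ?n)\<^sup>2) \<le> (1 - t) * d v"
    using assms(5) by (intro mult_left_mono) auto
  have "d x \<ge> d ?p + (1 - t) * ?g + 1 / 2 * ((1 - t) * ?n)\<^sup>2"
    using d_strong[OF p \<open>x \<in> Q\<close>] assms(5) unfolding x by (simp add: blinfun.bilinear_simps)
  then have 2: "t * (d ?p + (1 - t) * ?g + 1 / 2 * ((1 - t) * ?n)\<^sup>2) \<le> t * d x"
    using assms(4) by (intro mult_left_mono) auto
  have "(1 - t) * (b - t * g + 1 / 2 * (t * n)\<^sup>2) + t * (b + (1 - t) * g + 1 / 2 * ((1 - t) * n)\<^sup>2)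
      = b + 1 / 2 * t * (1 - t) * n\<^sup>2" for b g n :: real
    by (simp add: power2_eq_square field_simps)
  note this[of "d ?p" ?g ?n]
  with 1 2 show ?thesis by linarith
qed

lemma d_strong_interior_target:
  assumes "v \<in> Q" "x \<in> interior Q"
  shows "d v + blinfun_apply (gd v) (x - v) + 1 / 2 * (norm (x - v))\<^sup>2 \<le> d x"
proof -
  have x: "x \<in> Q" using assms(2) interior_subset by blast
  let ?q = "\<lambda>t. (d (v + t *\<^sub>R (x - v)) - d v) / t + 1 / 2 * (1 - t) * (norm (x - v))\<^sup>2"
  have "(?q \<longlongrightarrow> blinfun_apply (gd v) (x - v) + 1 / 2 * (1 - 0) * (norm (x - v))\<^sup>2) (at_right 0)"
    by (intro tendsto_intros directional_difference_quotient[OF d_differentiable convex_dom] assms x)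
  moreover have "\<forall>\<^sub>F t in at_right 0. ?q t \<le> d x - d v"
  proof -
    have "?q t \<le> d x - d v" if t: "0 < t" "t < 1" for t
    proof -
      have "d (v + t *\<^sub>R (x - v)) + 1 / 2 * t * (1 - t) * (norm (x - v))\<^sup>2 \<le> (1 - t) * d v + t * d x"
        using t assms x by (intro d_strong_chord convex_shrink_into_interior convex_dom) auto
      then have "d (v + t *\<^sub>R (x - v)) - d v \<le> (d x - d v - 1 / 2 * (1 - t) * (norm (x - v))\<^sup>2) * t"
        by (simp add: algebra_simps)
      then have "(d (v + t *\<^sub>R (x - v)) - d v) / t \<le> d x - d v - 1 / 2 * (1 - t) * (norm (x - v))\<^sup>2"
        using t by (subst pos_divide_le_eq) auto
      then show ?thesis by simp
    qed
    then show ?thesis by (auto simp: eventually_at_right[of 0 1] intro!: exI[of _ 1])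
  qed
  ultimately have "blinfun_apply (gd v) (x - v) + 1 / 2 * (1 - 0) * (norm (x - v))\<^sup>2 \<le> d x - d v"
    by (intro tendsto_upperbound) auto
  then show ?thesis by simp
qed

text \<open>
  Strong convexity of \<open>d\<close> is given at interior points only, whereas the minimizers of the
  method may lie on the boundary. Moving the target \<open>x\<close> towards an interior point makes
  the chord inequality available; the difference quotients along the chord then give the gradient
  inequality at \<open>v\<close>, and the target is moved back to \<open>x\<close>.
\<close>
lemma bregman_ge_quadratic:
  assumes "v \<in> Q" "x \<in> Q"
  shows "1 / 2 * (norm (x - v))\<^sup>2 \<le> bregman d gd v x"
proof -
  obtain w where w: "w \<in> interior Q" using interior_dom by blast
  have wQ: "w \<in> Q" using w interior_subset by blast
  let ?x = "\<lambda>t. x + t *\<^sub>R (w - x)"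
  let ?l = "\<lambda>t. d v + blinfun_apply (gd v) (?x t - v) + 1 / 2 * (norm (?x t - v))\<^sup>2"
  let ?r = "\<lambda>t. (1 - t) * d x + t * d w"
  have "?l t \<le> ?r t" if t: "0 < t" "t < 1" for t
  proof -
    have "?l t \<le> d (?x t)"
      using t w assms by (intro d_strong_interior_target convex_shrink_into_interior convex_dom) auto
    also have "d (?x t) = d ((1 - t) *\<^sub>R x + t *\<^sub>R w)" by (simp add: algebra_simps)
    also have "\<dots> \<le> ?r t" using t wQ assms by (intro convex_onD[OF d_convex]) auto
    finally show ?thesis .
  qed
  then have "\<forall>\<^sub>F t in at_right 0. ?l t \<le> ?r t"
    by (auto simp: eventually_at_right[of 0 1] intro!: exI[of _ 1])
  moreover have "(?l \<longlongrightarrow> ?l 0) (at_right 0)"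
    by (intro tendsto_intros blinfun.tendsto)
  moreover have "(?r \<longlongrightarrow> ?r 0) (at_right 0)"
    by (intro tendsto_intros)
  ultimately have "?l 0 \<le> ?r 0"
    by (intro tendsto_le[of "at_right 0" ?r _ ?l]) auto
  then show ?thesis by (simp add: bregman_def)
qed

text \<open>
  The shape shared by the estimating functions and the objectives of the auxiliary problems. It
  is preserved by the updates of the method and guarantees growth away from a minimizer by at least
  the Bregman distance.
\<close>
definition prox_composite :: "real \<Rightarrow> ('a \<Rightarrow> real) \<Rightarrow> bool" where
  "prox_composite A F \<longleftrightarrow> 0 \<le> A \<and>
     (\<exists>(g :: 'a \<Rightarrow>\<^sub>L real) c. F = (\<lambda>z. d z + blinfun_apply g z + c + A * Psi z))"

lemma prox_composite_bregman: "prox_composite 0 (bregman d gd v)"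
  unfolding prox_composite_def bregman_def
  by (intro conjI exI[of _ "- gd v"] exI[of _ "blinfun_apply (gd v) v - d v"])
     (auto simp: blinfun.bilinear_simps)

lemma prox_composite_add:
  assumes "prox_composite A F" "0 \<le> a"
  shows "prox_composite (A + a) (\<lambda>z. F z + a * (c + blinfun_apply g (z - x) + Psi z))"
proof -
  obtain h b where F: "F = (\<lambda>z. d z + blinfun_apply h z + b + A * Psi z)" and A: "0 \<le> A"
    using assms(1) by (auto simp: prox_composite_def)
  show ?thesis
    unfolding prox_composite_def F
    using A assms(2)
    by (intro conjI exI[of _ "h + a *\<^sub>R g"] exI[of _ "b + a * (c - blinfun_apply g x)"])
       (auto simp: blinfun.bilinear_simps algebra_simps)
qed

text \<open>
  First-order optimality: the difference quotients of \<open>d\<close> at the minimizer towards \<open>x\<close>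
  are bounded below by the decrease of the affine part and of the convex part.
\<close>
lemma prox_composite_growth:
  assumes F: "prox_composite A F" and v: "is_arg_min F (\<lambda>z. z \<in> Q) v" and x: "x \<in> Q"
  shows "F v + bregman d gd v x \<le> F x"
proof -
  obtain g c where F_eq: "F = (\<lambda>z. d z + blinfun_apply g z + c + A * Psi z)" and A: "0 \<le> A"
    using F by (auto simp: prox_composite_def)
  have vQ: "v \<in> Q" and v_le: "\<And>z. z \<in> Q \<Longrightarrow> F v \<le> F z"
    using v by (auto simp: is_arg_min_def not_less)
  let ?K = "- blinfun_apply g (x - v) - A * (Psi x - Psi v)"
  have "?K \<le> (d (v + t *\<^sub>R (x - v)) - d v) / t" if t: "0 < t" "t < 1" for t
  proof -
    have eq: "v + t *\<^sub>R (x - v) = (1 - t) *\<^sub>R v + t *\<^sub>R x" by (simp add: algebra_simps)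
    have "v + t *\<^sub>R (x - v) \<in> Q" unfolding eq using convex_dom vQ x t by (simp add: convexD_alt)
    from v_le[OF this] have "d v + A * Psi v
        \<le> d (v + t *\<^sub>R (x - v)) + t * blinfun_apply g (x - v) + A * Psi (v + t *\<^sub>R (x - v))"
      by (simp add: F_eq blinfun.bilinear_simps)
    moreover have "A * Psi (v + t *\<^sub>R (x - v)) \<le> A * ((1 - t) * Psi v + t * Psi x)"
      unfolding eq using t vQ x A by (intro mult_left_mono convex_onD[OF Psi_convex]) auto
    ultimately have "?K * t \<le> d (v + t *\<^sub>R (x - v)) - d v" by (simp add: algebra_simps)
    then show ?thesis using t by (simp add: pos_le_divide_eq)
  qed
  then have "\<forall>\<^sub>F t in at_right 0. ?K \<le> (d (v + t *\<^sub>R (x - v)) - d v) / t"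
    by (auto simp: eventually_at_right[of 0 1] intro!: exI[of _ 1])
  then have "?K \<le> blinfun_apply (gd v) (x - v)"
    using directional_difference_quotient[OF d_differentiable[OF vQ] convex_dom vQ x]
    by (intro tendsto_lowerbound) auto
  then show ?thesis by (simp add: F_eq bregman_def blinfun.bilinear_simps algebra_simps)
qed

lemma prox_composite_minimizer_unique:
  assumes F: "prox_composite A F"
    and v: "is_arg_min F (\<lambda>z. z \<in> Q) v" and w: "is_arg_min F (\<lambda>z. z \<in> Q) w"
  shows "v = w"
proof -
  have Q: "v \<in> Q" "w \<in> Q" and "F w \<le> F v" using v w by (auto simp: is_arg_min_def not_less)
  then have "1 / 2 * (norm (w - v))\<^sup>2 \<le> 0"
    using prox_composite_growth[OF F v Q(2)] bregman_ge_quadratic[OF Q] by linarith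
  then show ?thesis by simp
qed

end

section \<open>Step coefficients and termination of the line search\<close>

lemma step_coefficient_exists:
  fixes A M :: real
  assumes "0 \<le> A" "0 < M"
  obtains a where "0 < a" "M * a\<^sup>2 = A + a"
proof
  define r where "r = sqrt (1 + 4 * A * M)"
  have r: "r\<^sup>2 = 1 + 4 * A * M" "0 \<le> r" using assms by (auto simp: r_def)
  show "0 < (1 + r) / (2 * M)" using r(2) assms by (intro divide_pos_pos) auto
  have "M * ((1 + r) / (2 * M))\<^sup>2 = (1 + 2 * r + r\<^sup>2) / (4 * M)"
    using assms by (simp add: power2_eq_square field_simps)
  also have "\<dots> = A + (1 + r) / (2 * M)"
    unfolding r(1) using assms by (simp add: field_simps)
  finally show "M * ((1 + r) / (2 * M))\<^sup>2 = A + (1 + r) / (2 * M)" .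
qed

text \<open>
  The quotient \<open>u = A / a\<close> solves \<open>u * (1 + u) = A * M\<close> and so increases with \<open>A * M\<close>, while
  the step ratio is \<open>1 / (1 + u)\<close>.
\<close>
lemma step_ratio_antimono:
  fixes A A' M M' a b :: real
  assumes a: "0 < a" "M * a\<^sup>2 = A + a" and b: "0 < b" "M' * b\<^sup>2 = A' + b"
    and A: "0 \<le> A" "A \<le> A'" and M: "0 \<le> M" "M \<le> M'"
  shows "b / (A' + b) \<le> a / (A + a)"
proof (rule ccontr)
  assume "\<not> ?thesis"
  then have "a * (A' + b) < b * (A + a)"
    using a b A by (simp add: divide_less_eq not_le field_simps add_pos_nonneg)
  then have less: "a * A' < b * A" by (simp add: algebra_simps)
  have eqs: "(A / a) * (1 + A / a) = A * M" "(A' / b) * (1 + A' / b) = A' * M'"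
  proof -
    have "1 + A / a = M * a" using a by (simp add: field_simps power2_eq_square)
    then show "(A / a) * (1 + A / a) = A * M" using a(1) by simp
    have "1 + A' / b = M' * b" using b by (simp add: field_simps power2_eq_square)
    then show "(A' / b) * (1 + A' / b) = A' * M'" using b(1) by simp
  qed
  have "A' / b < A / a" using less a(1) b(1) by (simp add: field_simps)
  moreover have "0 \<le> A' / b" using A b by simp
  ultimately have "(A' / b) * (1 + A' / b) < (A / a) * (1 + A / a)"
    by (intro mult_strict_mono) auto
  then have "A' * M' < A * M" unfolding eqs .
  moreover have "A * M \<le> A' * M'" using A M by (intro mult_mono) auto
  ultimately show False by simp
qed

text \<open>
  Two different solutions would satisfy \<open>M * (a + b) = 1\<close>, but each of them satisfies
  \<open>M * a \<ge> 1\<close> by itself.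
\<close>
lemma step_coefficient_unique:
  fixes A M a b :: real
  assumes "0 < a" "M * a\<^sup>2 = A + a" "0 < b" "M * b\<^sup>2 = A + b" "0 \<le> A"
  shows "a = b"
proof (rule ccontr)
  assume "a \<noteq> b"
  have "M * (a + b) * (a - b) = 1 * (a - b)"
    using assms(2,4) by (simp add: algebra_simps power2_eq_square)
  then have "M * (a + b) = 1" using \<open>a \<noteq> b\<close> by (simp only: mult_cancel_right) simp
  then have 1: "M * a + M * b = 1" by (simp add: algebra_simps)
  have "1 * a \<le> (M * a) * a" using assms by (simp add: power2_eq_square algebra_simps)
  then have "1 \<le> M * a" using assms(1) by simp
  moreover have "1 * b \<le> (M * b) * b" using assms by (simp add: power2_eq_square algebra_simps)
  then have "1 \<le> M * b" using assms(3) by simp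
  ultimately show False using 1 by simp
qed

lemma step_ratio_square:
  fixes A M a :: real
  assumes "0 < a" "M * a\<^sup>2 = A + a" "0 \<le> A"
  shows "(A + a) * (a / (A + a))\<^sup>2 * M = 1"
proof -
  have "0 < A + a" using assms by simp
  have "(A + a) * (a / (A + a))\<^sup>2 * M = (M * a\<^sup>2) / (A + a)"
    using \<open>0 < A + a\<close> by (simp add: power2_eq_square)
  also have "\<dots> = 1" unfolding assms(2) using \<open>0 < A + a\<close> by simp
  finally show ?thesis .
qed

text \<open>
  Raising \<open>M\<close> shrinks the step ratio \<open>\<tau>\<close> and so raises the right-hand side of the sufficient
  condition for acceptance; the point is that \<open>M\<close> wins. With \<open>s\<close> the gauge at
  \<open>e * \<tau> / 2\<close>, the condition reads \<open>e * \<tau> \<le> M * s\<^sup>2\<close>. With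
  \<open>S = A + a\<close> one has \<open>M * S * \<tau>\<^sup>2 = 1\<close>, so this amounts to \<open>e * \<tau>\<^sup>3 * S \<le> s\<^sup>2\<close>. For small
  \<open>s\<close> the curvature bound is at most \<open>s\<close>, so \<open>\<tau>\<close> is at most a multiple of \<open>s\<close> and the
  left-hand side is of third order in \<open>s\<close>, as \<open>S\<close> stays bounded. For \<open>A = 0\<close> the ratio is constantly 1.
\<close>
lemma (in regular_convex) line_search_threshold:
  assumes "0 < e" "0 \<le> A"
  obtains M0 where "\<And>M a. \<lbrakk>M0 \<le> M; 0 < a; M * a\<^sup>2 = A + a\<rbrakk> \<Longrightarrow> gamma_gauge f (e * (a / (A + a))) \<le> M"
proof (cases "A = 0")
  case True
  show thesis by (rule that[of "gamma_gauge f e"]) (simp add: True)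
next
  case False
  then have A: "0 < A" using assms(2) by simp
  \<comment> \<open>A bound on \<open>A + a\<close>, valid as soon as \<open>M \<ge> 1\<close>.\<close>
  define C where "C = 2 * A + 1"
  have C: "0 < C" using A by (simp add: C_def)
  obtain r where r: "0 < r" "\<And>t. \<lbrakk>0 \<le> t; t \<le> r\<rbrakk> \<Longrightarrow> curv f t \<le> 1 * t"
    using curv_sublinear_at_0[OF reg, of 1] by auto
  define \<delta> where "\<delta> = min r (e\<^sup>2 / (8 * C))"
  have \<delta>: "0 < \<delta>" "\<delta> \<le> r" "\<delta> \<le> e\<^sup>2 / (8 * C)" using r(1) assms(1) C by (auto simp: \<delta>_def)
  define m where "m = curv f \<delta>"
  have m: "0 < m" unfolding m_def by (rule curv_pos[OF \<delta>(1)])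
  \<comment> \<open>The second threshold forces \<open>e * \<tau> / 2 < m\<close>, and hence a gauge below \<open>\<delta>\<close>.\<close>
  show thesis
  proof (rule that[of "max 1 (e\<^sup>2 / (4 * A * m\<^sup>2) + 1)"])
    fix M a :: real
    assume M: "max 1 (e\<^sup>2 / (4 * A * m\<^sup>2) + 1) \<le> M" and a: "0 < a" "M * a\<^sup>2 = A + a"
    define S \<tau> where "S = A + a" and "\<tau> = a / S"
    have S: "0 < S" "A \<le> S" using A a by (auto simp: S_def)
    have \<tau>: "0 < \<tau>" using a(1) S by (simp add: \<tau>_def)
    have \<tau>2: "S * \<tau>\<^sup>2 * M = 1" using step_ratio_square[OF a] A by (simp add: S_def \<tau>_def)
    have "a \<le> 1 + A"
    proof (rule ccontr)
      assume "\<not> ?thesis"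
      then have "1 + A < a" by simp
      then have "(1 + A) * a < a * a" "A * 1 < A * a" using a(1) A by auto
      moreover have "1 * a\<^sup>2 \<le> M * a\<^sup>2" using M by (intro mult_right_mono) auto
      ultimately show False using a(2) by (simp add: power2_eq_square algebra_simps)
    qed
    then have SC: "S \<le> C" by (simp add: S_def C_def)
    have small: "e * \<tau> / 2 < m"
    proof -
      have "e\<^sup>2 / (4 * A * m\<^sup>2) < M" using M by simp
      then have "e\<^sup>2 < M * (4 * A * m\<^sup>2)" using A m by (simp add: pos_divide_less_eq)
      moreover have "e\<^sup>2 * (A * \<tau>\<^sup>2 * M) \<le> e\<^sup>2 * (S * \<tau>\<^sup>2 * M)"
        using S M by (intro mult_left_mono mult_right_mono) auto
      ultimately have "e\<^sup>2 * (A * \<tau>\<^sup>2 * M) < M * (4 * A * m\<^sup>2)" by (simp add: \<tau>2)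
      then have "(A * M) * (e * \<tau>)\<^sup>2 < (A * M) * (2 * m)\<^sup>2"
        by (simp add: algebra_simps power2_eq_square)
      then have "(e * \<tau>)\<^sup>2 < (2 * m)\<^sup>2" using A M by (simp add: mult_less_cancel_left_pos)
      then have "e * \<tau> < 2 * m" using m by (intro power2_less_imp_less[of "e * \<tau>"]) auto
      then show ?thesis by simp
    qed
    define s where "s = complexity_gauge f (e * \<tau> / 2)"
    have e\<tau>: "0 < e * \<tau> / 2" using assms(1) \<tau> by simp
    note s = complexity_gauge[OF e\<tau>, folded s_def]
    have "s < \<delta>"
      unfolding s_def using small \<delta>(1) by (intro complexity_gauge_lessI e\<tau>) (auto simp: m_def)
    then have le_s: "e * \<tau> / 2 \<le> s" using r(2)[of s] s \<delta> by simp
    have "e * \<tau> * (S * \<tau>\<^sup>2) = 8 / e\<^sup>2 * S * (e * \<tau> / 2) ^ 3"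
      using assms(1) by (simp add: power2_eq_square power3_eq_cube field_simps)
    also have "\<dots> \<le> 8 / e\<^sup>2 * C * s ^ 3"
      using SC C le_s e\<tau> S by (intro mult_mono power_mono) auto
    also have "\<dots> = (8 * C / e\<^sup>2 * s) * s\<^sup>2" by (simp add: power2_eq_square power3_eq_cube)
    also have "\<dots> \<le> 1 * s\<^sup>2"
    proof (rule mult_right_mono)
      have "s \<le> e\<^sup>2 / (8 * C)" using \<open>s < \<delta>\<close> \<delta>(3) by simp
      then show "8 * C / e\<^sup>2 * s \<le> 1" using C assms(1) by (simp add: field_simps)
    qed simp
    finally have "M * (e * \<tau> * (S * \<tau>\<^sup>2)) \<le> M * s\<^sup>2" using M by (intro mult_left_mono) auto
    moreover have "M * (e * \<tau> * (S * \<tau>\<^sup>2)) = e * \<tau> * (S * \<tau>\<^sup>2 * M)" by (simp add: algebra_simps)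
    ultimately have "e * \<tau> \<le> M * s\<^sup>2" by (simp add: \<tau>2)
    then have "gamma_gauge f (e * \<tau>) \<le> M"
      using s(1) by (simp add: gamma_gauge_def s_def[symmetric] pos_divide_le_eq)
    then show "gamma_gauge f (e * (a / (A + a))) \<le> M" by (simp add: \<tau>_def S_def)
  qed
qed

section \<open>One iteration of the method\<close>

locale ufgm = regular_convex f gf + prox_domain Q Psi d gd
  for f :: "'a::real_normed_vector \<Rightarrow> real"
    and gf :: "'a \<Rightarrow> 'a \<Rightarrow>\<^sub>L real"
    and Q :: "'a set"
    and Psi :: "'a \<Rightarrow> real"
    and d :: "'a \<Rightarrow> real"
    and gd :: "'a \<Rightarrow> 'a \<Rightarrow>\<^sub>L real" +
  fixes x0 :: 'a
    and L0 \<epsilon> :: real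
  assumes x0_in: "x0 \<in> Q"
    and eps_pos: "0 < \<epsilon>"
    and L0_pos: "0 < L0"
    and L0_le: "L0 \<le> 2 * gamma_gauge f \<epsilon>"
begin

abbreviation "accepts \<equiv> ufgm_accepts f gf Q Psi d gd \<epsilon>"
abbreviation "step \<equiv> ufgm_step f gf Q Psi d gd \<epsilon>"
abbreviation minimizes :: "('a \<Rightarrow> real) \<Rightarrow> 'a \<Rightarrow> bool" where
  "minimizes F v \<equiv> is_arg_min F (\<lambda>z. z \<in> Q) v"

definition wf_state :: "'a ufgm_state \<Rightarrow> bool" where
  "wf_state s \<longleftrightarrow> 0 < st_L s \<and> st_y s \<in> Q \<and> prox_composite (st_A s) (st_phi s)"

text \<open>
  The inequality to be proved between \<open>A_k\<close>, \<open>y_k\<close> and the minimum of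
  \<open>\<phi>_k\<close>, quantified over the domain so that no minimizer has to be named.
\<close>
definition certified :: "'a ufgm_state \<Rightarrow> bool" where
  "certified s \<longleftrightarrow>
     (\<forall>x\<in>Q. st_A s * (f (st_y s) + Psi (st_y s) - 1 / 2 * \<epsilon>) \<le> st_phi s x)"

text \<open>
  Before the first iteration \<open>A_0 = 0\<close> and there is no coefficient \<open>a_0\<close>; the step ratio
  to compare with is then 1, the value that the first iteration produces. Afterwards, the
  quadratic equation of the last iteration is kept, since it ties the last step ratio to
  \<open>L_k\<close> and \<open>A_k\<close>.
\<close>
definition L_bounded :: "'a ufgm_state \<Rightarrow> bool" where
  "L_bounded s \<longleftrightarrow>
     (if st_A s = 0 then st_L s \<le> 2 * gamma_gauge f \<epsilon>
      else 0 < st_a s \<and> st_a s \<le> st_A s \<and> st_L s * (st_a s)\<^sup>2 = st_A s \<and>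
           st_L s \<le> 2 * gamma_gauge f (\<epsilon> * (st_a s / st_A s)))"

lemma wf_state_A_nonneg: "wf_state s \<Longrightarrow> 0 \<le> st_A s"
  by (simp add: wf_state_def prox_composite_def)

lemma minimizes_in: "minimizes F v \<Longrightarrow> v \<in> Q"
  by (simp add: is_arg_min_def)

lemma minimizes_le: "minimizes F v \<Longrightarrow> x \<in> Q \<Longrightarrow> F v \<le> F x"
  by (auto simp: is_arg_min_def not_less)

lemma ufgm_coeff_iff:
  assumes "wf_state s"
  shows "ufgm_coeff s i a \<longleftrightarrow> 0 < a \<and> (2 ^ i * st_L s) * a\<^sup>2 = st_A s + a"
proof -
  have "0 < 2 ^ i * st_L s" using assms by (simp add: wf_state_def)
  then have "a\<^sup>2 = 1 / (2 ^ i * st_L s) * (st_A s + a) \<longleftrightarrow> (2 ^ i * st_L s) * a\<^sup>2 = st_A s + a"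
    by (auto simp: eq_divide_eq mult.commute)
  then show ?thesis unfolding ufgm_coeff_def by blast
qed

lemma prox_composite_aux:
  assumes "0 \<le> a"
  shows "prox_composite a (ufgm_aux gf Psi d gd s v a)"
  using prox_composite_add[OF prox_composite_bregman assms, of v 0 "gf (ufgm_x s v a)" 0]
  by (simp add: ufgm_aux_def[abs_def])

lemma accepts_if_gamma_le:
  assumes "ufgm_coeff s i a" "minimizes (ufgm_aux gf Psi d gd s v a) xhat" "wf_state s"
    and \<gamma>: "gamma_gauge f (\<epsilon> * ufgm_tau s a) \<le> 2 ^ i * st_L s"
  shows "accepts s v i a xhat"
proof -
  have "0 < ufgm_tau s a"
    using assms(1) wf_state_A_nonneg[OF assms(3)] by (simp add: ufgm_tau_def ufgm_coeff_def)
  then have "0 < \<epsilon> * ufgm_tau s a" using eps_pos by simp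
  from inexact_quadratic_bound[OF this \<gamma>] show ?thesis
    using assms(1,2) by (simp add: ufgm_accepts_def Let_def)
qed

text \<open>
  The doubling \<open>2 ^ i * L_k\<close> eventually exceeds the threshold of the line search, so some
  index is accepted, and then there is a smallest one.
\<close>
lemma step_exists:
  assumes s: "wf_state s" and solv: "ufgm_solvable gf Q Psi d gd s"
  shows "\<exists>s'. step s s'"
proof -
  obtain v where v: "minimizes (st_phi s) v" using solv by (auto simp: ufgm_solvable_def)
  have L: "0 < st_L s" using s by (simp add: wf_state_def)
  have "\<exists>i a xhat. accepts s v i a xhat"
  proof -
    obtain M0 where M0: "\<And>M a. \<lbrakk>M0 \<le> M; 0 < a; M * a\<^sup>2 = st_A s + a\<rbrakk>
        \<Longrightarrow> gamma_gauge f (\<epsilon> * (a / (st_A s + a))) \<le> M"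
      using line_search_threshold[OF eps_pos wf_state_A_nonneg[OF s]] by blast
    obtain i where "M0 / st_L s < 2 ^ i" using real_arch_pow[of 2 "M0 / st_L s"] by auto
    then have i: "M0 \<le> 2 ^ i * st_L s" using L by (simp add: pos_divide_less_eq)
    obtain a where a: "0 < a" "(2 ^ i * st_L s) * a\<^sup>2 = st_A s + a"
      using step_coefficient_exists[OF wf_state_A_nonneg[OF s], of "2 ^ i * st_L s"] L by auto
    then have coeff: "ufgm_coeff s i a" by (simp add: ufgm_coeff_iff[OF s])
    then obtain xhat where "minimizes (ufgm_aux gf Psi d gd s v a) xhat"
      using solv v unfolding ufgm_solvable_def by blast
    then have "accepts s v i a xhat"
      using M0[OF i a] coeff s by (intro accepts_if_gamma_le) (auto simp: ufgm_tau_def)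
    then show ?thesis by blast
  qed
  then have "\<exists>b z. accepts s v (LEAST i. \<exists>b z. accepts s v i b z) b z" by (rule LeastI_ex)
  moreover have "\<forall>j < (LEAST i. \<exists>b z. accepts s v i b z). \<not> (\<exists>b z. accepts s v j b z)"
    using not_less_Least by blast
  ultimately show ?thesis using v unfolding ufgm_step_def Let_def by blast
qed

lemma accepts_unique:
  assumes s: "wf_state s" and "accepts s v i a xhat" "accepts s v i b z"
  shows "a = b" "xhat = z"
proof -
  have co: "ufgm_coeff s i a" "ufgm_coeff s i b" using assms(2,3) by (auto simp: ufgm_accepts_def)
  then show ab: "a = b"
    using step_coefficient_unique wf_state_A_nonneg[OF s] by (auto simp: ufgm_coeff_iff[OF s])
  have "0 \<le> a" using co(1) by (simp add: ufgm_coeff_def)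
  from prox_composite_minimizer_unique[OF prox_composite_aux[OF this]] show "xhat = z"
    using assms(2,3) unfolding ab ufgm_accepts_def by blast
qed

lemma step_unique:
  assumes s: "wf_state s" and "step s s1" "step s s2"
  shows "s1 = s2"
proof -
  have phi: "prox_composite (st_A s) (st_phi s)" using s by (simp add: wf_state_def)
  obtain v i a xhat where 1: "minimizes (st_phi s) v" "accepts s v i a xhat"
      "\<forall>j<i. \<not> (\<exists>b z. accepts s v j b z)"
    and s1: "s1 = \<lparr>st_x = ufgm_x s v a, st_y = ufgm_y s a xhat, st_a = a, st_A = st_A s + a,
      st_L = 2 ^ i * st_L s, st_phi = (\<lambda>z. st_phi s z + a * (f (ufgm_x s v a)
        + blinfun_apply (gf (ufgm_x s v a)) (z - ufgm_x s v a) + Psi z))\<rparr>"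
    using assms(2) unfolding ufgm_step_def Let_def by blast
  obtain w j b xtilde where 2: "minimizes (st_phi s) w" "accepts s w j b xtilde"
      "\<forall>i<j. \<not> (\<exists>b z. accepts s w i b z)"
    and s2: "s2 = \<lparr>st_x = ufgm_x s w b, st_y = ufgm_y s b xtilde, st_a = b, st_A = st_A s + b,
      st_L = 2 ^ j * st_L s, st_phi = (\<lambda>z. st_phi s z + b * (f (ufgm_x s w b)
        + blinfun_apply (gf (ufgm_x s w b)) (z - ufgm_x s w b) + Psi z))\<rparr>"
    using assms(3) unfolding ufgm_step_def Let_def by blast
  have v: "w = v" using prox_composite_minimizer_unique[OF phi 2(1) 1(1)] .
  have i: "j = i"
    using 1(2,3) 2(2,3) unfolding v by (metis linorder_neqE_nat)
  show ?thesis
    using accepts_unique[OF s 1(2) 2(2)[unfolded v i]] unfolding s1 s2 v i by simp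
qed

text \<open>
  The estimating function grows from its minimizer \<open>v\<close> by at least the Bregman distance, and
  the auxiliary problem minimizes the resulting lower bound, so \<open>x\<close> may be replaced by
  \<open>xhat\<close>. Linearizing \<open>f (st_y s)\<close> at \<open>X\<close> and using convexity of \<open>Psi\<close> collects
  everything in the point \<open>Y\<close>. As \<open>Y - X = \<tau> (xhat - v)\<close> and
  \<open>S * \<tau>\<^sup>2 * M = 1\<close>, the quadratic lower bound of the Bregman distance pays exactly for the quadratic term of the
  acceptance test, whose tolerance adds up to \<open>a * \<epsilon> / 2\<close>.
\<close>
lemma estimate_step:
  assumes s: "wf_state s" "certified s"
    and v: "minimizes (st_phi s) v" and acc: "accepts s v i a xhat" and x: "x \<in> Q"
  defines "X \<equiv> ufgm_x s v a" and "Y \<equiv> ufgm_y s a xhat"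
  shows "(st_A s + a) * (f Y + Psi Y - 1 / 2 * \<epsilon>)
    \<le> st_phi s x + a * (f X + blinfun_apply (gf X) (x - X) + Psi x)"
proof -
  define A y M \<tau> where "A = st_A s" and "y = st_y s" and "M = 2 ^ i * st_L s" and "\<tau> = ufgm_tau s a"
  define S where "S = A + a"
  define G where "G = blinfun_apply (gf X)"
  have A: "0 \<le> A" using wf_state_A_nonneg[OF s(1)] by (simp add: A_def)
  have a: "0 < a" "M * a\<^sup>2 = A + a"
    using acc by (auto simp: ufgm_accepts_def ufgm_coeff_iff[OF s(1)] A_def M_def)
  have xhat: "minimizes (ufgm_aux gf Psi d gd s v a) xhat" using acc by (simp add: ufgm_accepts_def)
  have S: "0 < S" using A a by (simp add: S_def)
  have \<tau>: "S * \<tau> = a" "S * (1 - \<tau>) = A" "0 \<le> \<tau>" "\<tau> \<le> 1"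
  proof -
    have "\<tau> = a / S" by (simp add: \<tau>_def ufgm_tau_def S_def A_def)
    then show "S * \<tau> = a" "0 \<le> \<tau>" "\<tau> \<le> 1" using S A a by (auto simp: S_def)
    then show "S * (1 - \<tau>) = A" by (simp add: right_diff_distrib) (simp add: S_def)
  qed
  have \<tau>2: "S * \<tau>\<^sup>2 * M = 1"
    using step_ratio_square[OF a A] by (simp add: S_def \<tau>_def ufgm_tau_def A_def)
  have inQ: "y \<in> Q" "v \<in> Q" "xhat \<in> Q"
    using s(1) v xhat by (auto simp: wf_state_def y_def minimizes_in)
  have X: "X = \<tau> *\<^sub>R v + (1 - \<tau>) *\<^sub>R y" by (simp add: X_def ufgm_x_def \<tau>_def y_def)
  have Y: "Y = \<tau> *\<^sub>R xhat + (1 - \<tau>) *\<^sub>R y" by (simp add: Y_def ufgm_y_def \<tau>_def y_def)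
  have "Y - X = \<tau> *\<^sub>R (xhat - v)" by (simp add: X Y algebra_simps)
  then have YX_norm: "(norm (Y - X))\<^sup>2 = \<tau>\<^sup>2 * (norm (xhat - v))\<^sup>2"
    by (simp only: norm_scaleR power_mult_distrib power2_abs)

  have "bregman d gd v xhat + a * (G xhat + Psi xhat) \<le> bregman d gd v x + a * (G x + Psi x)"
    using minimizes_le[OF xhat x] by (simp add: ufgm_aux_def G_def X_def)
  moreover have "st_phi s v + bregman d gd v x \<le> st_phi s x"
    using prox_composite_growth[OF _ v x] s(1) unfolding wf_state_def by blast
  moreover have "1 / 2 * (norm (xhat - v))\<^sup>2 \<le> bregman d gd v xhat"
    by (rule bregman_ge_quadratic[OF inQ(2,3)])
  moreover have "A * (f y + Psi y - 1 / 2 * \<epsilon>) \<le> st_phi s v"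
    using s(2) inQ(2) by (simp add: certified_def A_def y_def)
  moreover have "A * (f X + G (y - X)) \<le> A * f y"
    unfolding G_def by (intro mult_left_mono subgradient A)
  ultimately have phi: "A * (f X + G (y - X)) + A * Psi y - A * \<epsilon> / 2 + 1 / 2 * (norm (xhat - v))\<^sup>2
      + a * (f X + G (xhat - X) + Psi xhat) \<le> st_phi s x + a * (f X + G (x - X) + Psi x)"
    by (simp add: G_def blinfun.bilinear_simps algebra_simps)

  have "S * Psi Y \<le> S * ((1 - \<tau>) * Psi y + \<tau> * Psi xhat)"
    using convex_onD[OF Psi_convex \<tau>(3,4) inQ(1,3)] S by (simp add: Y add.commute)
  also have "\<dots> = (S * (1 - \<tau>)) * Psi y + (S * \<tau>) * Psi xhat" by (simp only: distrib_left mult.assoc)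
  finally have psi: "S * Psi Y \<le> A * Psi y + a * Psi xhat" unfolding \<tau>(1,2) .

  have "S * G (Y - X) = (S * (1 - \<tau>)) * G (y - X) + (S * \<tau>) * G (xhat - X)"
    by (simp add: Y G_def blinfun.bilinear_simps algebra_simps)
  then have lin: "S * G (Y - X) = A * G (y - X) + a * G (xhat - X)" unfolding \<tau>(1,2) .

  have "f Y \<le> f X + G (Y - X) + M / 2 * (norm (Y - X))\<^sup>2 + \<epsilon> / 2 * \<tau>"
    using acc by (simp add: ufgm_accepts_def Let_def X_def Y_def G_def M_def \<tau>_def)
  then have "S * f Y \<le> S * (f X + G (Y - X) + M / 2 * (norm (Y - X))\<^sup>2 + \<epsilon> / 2 * \<tau>)"
    using S by (intro mult_left_mono) auto
  also have "\<dots> = S * f X + S * G (Y - X) + (S * \<tau>\<^sup>2 * M) * (1 / 2 * (norm (xhat - v))\<^sup>2) + (S * \<tau>) * (\<epsilon> / 2)"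
    using YX_norm by (simp add: algebra_simps)
  finally have "S * f Y \<le> S * f X + (A * G (y - X) + a * G (xhat - X)) + 1 / 2 * (norm (xhat - v))\<^sup>2 + a * (\<epsilon> / 2)"
    unfolding \<tau>2 \<tau>(1) lin by simp
  moreover have "S * f X = A * f X + a * f X" "S * \<epsilon> = A * \<epsilon> + a * \<epsilon>"
    by (simp_all add: S_def distrib_right)
  ultimately have "S * f Y + S * Psi Y - S * \<epsilon> / 2 \<le> st_phi s x + a * (f X + G (x - X) + Psi x)"
    using phi psi unfolding distrib_left times_divide_eq_right by linarith
  then show ?thesis by (simp add: S_def A_def G_def algebra_simps)
qed

text \<open>
  A rejected index violates the sufficient condition for acceptance with its own step ratio; the
  next index has no larger a ratio, and \<open>\<gamma>\<^sub>f\<close> is nonincreasing.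
\<close>
lemma rejected_imp_less_gamma:
  assumes s: "wf_state s" and solv: "ufgm_solvable gf Q Psi d gd s" and v: "minimizes (st_phi s) v"
    and rej: "\<not> (\<exists>b z. accepts s v j b z)"
    and a: "0 < a" "(2 ^ Suc j * st_L s) * a\<^sup>2 = st_A s + a"
  shows "2 ^ j * st_L s < gamma_gauge f (\<epsilon> * (a / (st_A s + a)))"
proof -
  have L: "0 < st_L s" using s by (simp add: wf_state_def)
  obtain b where b: "0 < b" "(2 ^ j * st_L s) * b\<^sup>2 = st_A s + b"
    using step_coefficient_exists[OF wf_state_A_nonneg[OF s], of "2 ^ j * st_L s"] L by auto
  then have coeff: "ufgm_coeff s j b" by (simp add: ufgm_coeff_iff[OF s])
  then obtain z where "minimizes (ufgm_aux gf Psi d gd s v b) z"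
    using solv v unfolding ufgm_solvable_def by blast
  then have "2 ^ j * st_L s < gamma_gauge f (\<epsilon> * ufgm_tau s b)"
    using accepts_if_gamma_le[OF coeff _ s] rej by (meson not_le)
  also have "\<dots> \<le> gamma_gauge f (\<epsilon> * (a / (st_A s + a)))"
  proof (rule gamma_gauge_antimono)
    show "0 < \<epsilon> * (a / (st_A s + a))"
      using eps_pos a(1) wf_state_A_nonneg[OF s] by (simp add: add_nonneg_pos)
    have "a / (st_A s + a) \<le> b / (st_A s + b)"
      using L wf_state_A_nonneg[OF s] by (intro step_ratio_antimono[OF b a]) auto
    then show "\<epsilon> * (a / (st_A s + a)) \<le> \<epsilon> * ufgm_tau s b"
      unfolding ufgm_tau_def using eps_pos by (intro mult_left_mono) auto
  qed
  finally show ?thesis .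
qed

lemma step_ratio_le_previous:
  assumes s: "wf_state s" and b: "L_bounded s" "st_A s \<noteq> 0"
    and a: "0 < a" "M * a\<^sup>2 = st_A s + a" and M: "st_L s \<le> M"
  shows "a / (st_A s + a) \<le> st_a s / st_A s"
  using step_ratio_antimono[of "st_a s" "st_L s" "st_A s - st_a s" a M "st_A s"] assms
  by (simp add: L_bounded_def wf_state_def)

text \<open>
  For the bound on \<open>L\<close>: if the search moved past an index, the last rejected one gives the
  bound up to the factor 2; if the first index was accepted, \<open>L\<close> is unchanged and the old bound
  is carried over to a step ratio that is no larger.
\<close>
lemma step_preserves:
  assumes s: "wf_state s" "certified s" "L_bounded s"
    and solv: "ufgm_solvable gf Q Psi d gd s" and step: "step s s'"
  shows "wf_state s'" "certified s'" "L_bounded s'"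
    and "st_A s' = st_A s + st_a s'" "0 < st_a s'" "st_L s \<le> st_L s'"
proof -
  obtain v i a xhat where v: "minimizes (st_phi s) v" and acc: "accepts s v i a xhat"
    and rej: "\<forall>j<i. \<not> (\<exists>b z. accepts s v j b z)"
    and s': "s' = \<lparr>st_x = ufgm_x s v a, st_y = ufgm_y s a xhat, st_a = a, st_A = st_A s + a,
      st_L = 2 ^ i * st_L s, st_phi = (\<lambda>z. st_phi s z + a * (f (ufgm_x s v a)
        + blinfun_apply (gf (ufgm_x s v a)) (z - ufgm_x s v a) + Psi z))\<rparr>"
    using step unfolding ufgm_step_def Let_def by blast
  have L: "0 < st_L s" using s(1) by (simp add: wf_state_def)
  have A: "0 \<le> st_A s" by (rule wf_state_A_nonneg[OF s(1)])
  have a: "0 < a" "(2 ^ i * st_L s) * a\<^sup>2 = st_A s + a"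
    using acc by (auto simp: ufgm_accepts_def ufgm_coeff_iff[OF s(1)])
  have Lle: "st_L s \<le> 2 ^ i * st_L s" using L by simp
  show "st_A s' = st_A s + st_a s'" "0 < st_a s'" "st_L s \<le> st_L s'"
    using a Lle by (auto simp: s')
  have \<tau>: "0 \<le> a / (st_A s + a)" "a / (st_A s + a) \<le> 1" "0 < a / (st_A s + a)" using a A by auto
  show "wf_state s'"
  proof -
    have "ufgm_y s a xhat \<in> Q"
    proof -
      have "xhat \<in> Q" using acc unfolding ufgm_accepts_def by (blast intro: minimizes_in)
      moreover have "st_y s \<in> Q" using s(1) by (simp add: wf_state_def)
      ultimately show ?thesis
        using \<tau> unfolding ufgm_y_def ufgm_tau_def by (intro convexD[OF convex_dom]) auto
    qed
    moreover have "prox_composite (st_A s') (st_phi s')"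
      using s(1) a by (auto simp: s' wf_state_def intro!: prox_composite_add)
    ultimately show ?thesis using L by (simp add: wf_state_def s')
  qed
  show "certified s'"
    using estimate_step[OF s(1,2) v acc] by (simp add: certified_def s')
  have "2 ^ i * st_L s \<le> 2 * gamma_gauge f (\<epsilon> * (a / (st_A s + a)))"
  proof (cases i)
    case (Suc j)
    then have "2 ^ j * st_L s < gamma_gauge f (\<epsilon> * (a / (st_A s + a)))"
      using rej a by (intro rejected_imp_less_gamma[OF s(1) solv v]) auto
    then show ?thesis by (simp add: Suc)
  next
    case 0
    show ?thesis
    proof (cases "st_A s = 0")
      case True
      then show ?thesis using s(3) a(1) 0 by (simp add: L_bounded_def)
    next
      case False
      then have "st_L s \<le> 2 * gamma_gauge f (\<epsilon> * (st_a s / st_A s))"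
        using s(3) by (simp add: L_bounded_def)
      also have "\<dots> \<le> 2 * gamma_gauge f (\<epsilon> * (a / (st_A s + a)))"
        using step_ratio_le_previous[OF s(1,3) False a Lle] eps_pos \<tau>
        by (intro mult_left_mono gamma_gauge_antimono mult_pos_pos) auto
      finally show ?thesis by (simp add: 0)
    qed
  qed
  then show "L_bounded s'" using a A by (simp add: L_bounded_def s')
qed

section \<open>Runs of the method\<close>

lemma init_invariants:
  defines "s \<equiv> ufgm_init d gd x0 L0"
  shows "wf_state s" "certified s" "L_bounded s"
proof -
  show "wf_state s" "L_bounded s"
    using x0_in L0_pos L0_le prox_composite_bregman
    by (auto simp: s_def ufgm_init_def wf_state_def L_bounded_def)
  have "0 \<le> bregman d gd x0 x" if "x \<in> Q" for x
    using bregman_ge_quadratic[OF x0_in that] by (rule order_trans[rotated]) simp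
  then show "certified s" by (simp add: s_def ufgm_init_def certified_def)
qed

end

locale ufgm_solvable_run = ufgm +
  assumes solvable: "ufgm_reachable f gf Q Psi d gd x0 L0 \<epsilon> s \<Longrightarrow> ufgm_solvable gf Q Psi d gd s"
begin

lemma reachable_invariants:
  assumes "ufgm_reachable f gf Q Psi d gd x0 L0 \<epsilon> s"
  shows "wf_state s \<and> certified s \<and> L_bounded s"
  using assms unfolding ufgm_reachable_def
proof (induction rule: rtranclp_induct)
  case base
  then show ?case using init_invariants by simp
next
  case (step s s')
  then have "ufgm_solvable gf Q Psi d gd s" by (intro solvable) (simp add: ufgm_reachable_def)
  then show ?case using step step_preserves by blast
qed

lemma run_reachable:
  assumes "ufgm_run f gf Q Psi d gd x0 L0 \<epsilon> s"
  shows "ufgm_reachable f gf Q Psi d gd x0 L0 \<epsilon> (s k)"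
proof (induction k)
  case 0
  then show ?case using assms by (simp add: ufgm_run_def ufgm_reachable_def)
next
  case (Suc k)
  then show ?case
    using assms unfolding ufgm_run_def ufgm_reachable_def by (meson rtranclp.rtrancl_into_rtrancl)
qed

text \<open>
  With \<open>p\<close> and \<open>q\<close> the square roots of \<open>L_{k+1} A_k\<close> and \<open>L_{k+1} A_{k+1}\<close>, the
  coefficient equation says \<open>q\<^sup>2 - p\<^sup>2 = q\<close>. Since \<open>p + q \<le> 2 q\<close>, the root
  grows by at least one half in each iteration.
\<close>
lemma run_L_times_A_growth:
  assumes "ufgm_run f gf Q Psi d gd x0 L0 \<epsilon> s"
  shows "real k / 2 \<le> sqrt (st_L (s k) * st_A (s k))"
proof (induction k)
  case 0
  show ?case using assms by (simp add: ufgm_run_def ufgm_init_def)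
next
  case (Suc k)
  note inv = reachable_invariants[OF run_reachable[OF assms]]
  have step: "step (s k) (s (Suc k))" using assms by (simp add: ufgm_run_def)
  define a A A' L L' where "a = st_a (s (Suc k))" and "A = st_A (s k)" and "A' = st_A (s (Suc k))"
    and "L = st_L (s k)" and "L' = st_L (s (Suc k))"
  have pres: "A' = A + a" "0 < a" "L \<le> L'" "0 < L" "0 \<le> A"
    using step_preserves(4-6)[OF _ _ _ solvable[OF run_reachable[OF assms]] step] inv[of k]
      wf_state_A_nonneg[of "s k"]
    by (auto simp: a_def A_def A'_def L_def L'_def wf_state_def)
  have "L' * a\<^sup>2 = A'"
    using inv[of "Suc k"] pres by (auto simp: L_bounded_def a_def A'_def L'_def split: if_splits)
  then have "(L' * a)\<^sup>2 = L' * A'" by (simp add: power2_eq_square algebra_simps)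
  then have r: "L' * a = sqrt (L' * A')" using pres by (metis abs_of_nonneg less_imp_le mult_nonneg_nonneg order_trans real_sqrt_abs)
  define p q where "p = sqrt (L' * A)" and "q = sqrt (L' * A')"
  have pq: "0 \<le> p" "p\<^sup>2 = L' * A" "0 < q" "q\<^sup>2 = L' * A'" using pres by (auto simp: p_def q_def)
  have "q\<^sup>2 = p\<^sup>2 + q"
  proof -
    have "q = L' * a" unfolding q_def r ..
    then show ?thesis unfolding pq(2,4) by (simp add: pres(1) distrib_left)
  qed
  have "p + 1 / 2 \<le> q"
  proof -
    have "q * 1 = (q - p) * (q + p)"
      using \<open>q\<^sup>2 = p\<^sup>2 + q\<close> by (simp add: power2_eq_square algebra_simps)
    also have "\<dots> \<le> (q - p) * (2 * q)"
      using pres by (intro mult_left_mono) (auto simp: p_def q_def)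
    also have "\<dots> = q * (2 * (q - p))" by simp
    finally have "1 \<le> 2 * (q - p)" using pq(3) by (simp only: mult_le_cancel_left_pos)
    then show ?thesis by simp
  qed
  moreover have "sqrt (L * A) \<le> p" unfolding p_def using pres by (simp add: mult_right_mono)
  ultimately show ?case using Suc.IH by (simp add: A_def L_def A'_def L'_def q_def field_simps)
qed

text \<open>
  The step ratio is the reciprocal of the square root of \<open>L_{k+1} A_{k+1}\<close>.
\<close>
lemma run_step_ratio_le:
  assumes run: "ufgm_run f gf Q Psi d gd x0 L0 \<epsilon> s"
  shows "st_a (s (Suc k)) / st_A (s (Suc k)) \<le> 2 / (real k + 1)"
proof -
  define a A L where "a = st_a (s (Suc k))" and "A = st_A (s (Suc k))" and "L = st_L (s (Suc k))"
  have step: "step (s k) (s (Suc k))" using run by (simp add: ufgm_run_def)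
  note inv = reachable_invariants[OF run_reachable[OF run]]
  have pos: "0 < a" "0 < A" "0 < L"
    using step_preserves(4,5)[OF _ _ _ solvable[OF run_reachable[OF run]] step] inv[of k] inv[of "Suc k"]
      wf_state_A_nonneg[of "s k"]
    by (auto simp: a_def A_def L_def wf_state_def)
  have "L * a\<^sup>2 = A" using inv[of "Suc k"] pos by (auto simp: L_bounded_def a_def A_def L_def split: if_splits)
  then have "(a / A * sqrt (L * A))\<^sup>2 = 1\<^sup>2"
    using pos by (simp add: power_mult_distrib power_divide) (simp add: power2_eq_square field_simps)
  then have "a / A * sqrt (L * A) = 1"
    using pos by (subst (asm) power2_eq_iff_nonneg) auto
  moreover have "a / A * (real (Suc k) / 2) \<le> a / A * sqrt (L * A)"
    using run_L_times_A_growth[OF run, of "Suc k"] pos by (intro mult_left_mono) (auto simp: A_def L_def)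
  ultimately have "a / A * (real (Suc k) / 2) \<le> 1" by simp
  then have "a / A \<le> 2 / (real k + 1)" by (simp add: field_simps)
  then show ?thesis by (simp add: a_def A_def)
qed

end

theorem theorem6:
  fixes f :: "'a::real_normed_vector \<Rightarrow> real"
    and gf :: "'a \<Rightarrow> 'a \<Rightarrow>\<^sub>L real"
    and Q :: "'a set"
    and Psi :: "'a \<Rightarrow> real"
    and d :: "'a \<Rightarrow> real"
    and gd :: "'a \<Rightarrow> 'a \<Rightarrow>\<^sub>L real"
    and x0 :: 'a
    and L0 \<epsilon> :: real
  assumes finite_dim: "\<exists>B :: 'a set. finite B \<and> span B = UNIV"
    and f_convex: "convex_on UNIV f"
    and f_not_affine: "\<not> (\<exists>(g :: 'a \<Rightarrow>\<^sub>L real) c. \<forall>x. f x = blinfun_apply g x + c)"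
    and f_subgradient: "\<And>x y. f y \<ge> f x + blinfun_apply (gf x) (y - x)"
    and f_regular: "regular f"
    and Psi_convex: "convex_on Q Psi"
    and Psi_closed: "closed (epigraph Q Psi)"
    and interior_dom: "interior Q \<noteq> {}"
    and d_convex: "convex_on Q d"
    and d_differentiable: "\<And>x. x \<in> Q \<Longrightarrow> (d has_derivative blinfun_apply (gd x)) (at x within Q)"
    and d_strong: "\<And>x y. x \<in> interior Q \<Longrightarrow> y \<in> Q \<Longrightarrow>
          d y \<ge> d x + blinfun_apply (gd x) (y - x) + 1 / 2 * (norm (y - x))\<^sup>2"
    and x0_min: "is_arg_min d (\<lambda>x. x \<in> Q) x0"
    and d_x0: "d x0 = 0"
    and solvable: "\<And>s. ufgm_reachable f gf Q Psi d gd x0 L0 \<epsilon> s \<Longrightarrow> ufgm_solvable gf Q Psi d gd s"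
    and eps_pos: "0 < \<epsilon>"
    and L0_pos: "0 < L0"
    and L0_le: "L0 \<le> 2 * gamma_gauge f \<epsilon>"
  shows "(\<forall>s. ufgm_reachable f gf Q Psi d gd x0 L0 \<epsilon> s \<longrightarrow>
            (\<exists>!s'. ufgm_step f gf Q Psi d gd \<epsilon> s s')) \<and>
         (\<forall>s \<tau>. ufgm_run f gf Q Psi d gd x0 L0 \<epsilon> s \<longrightarrow>
            (\<forall>k. \<tau> k = st_a (s (Suc k)) / st_A (s (Suc k))) \<longrightarrow>
            (\<forall>k. st_L (s (Suc k)) \<le> 2 * gamma_gauge f (\<epsilon> * \<tau> k) \<and>
                 \<tau> (Suc k) \<le> \<tau> k \<and> \<tau> k \<le> 2 / (real k + 1) \<and>
                 st_y (s k) \<in> Q \<and>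
                 (\<exists>v. is_arg_min (st_phi (s k)) (\<lambda>x. x \<in> Q) v \<and>
                      st_A (s k) * (f (st_y (s k)) + Psi (st_y (s k)) - 1 / 2 * \<epsilon>)
                        \<le> st_phi (s k) v)))"
proof -
  interpret ufgm_solvable_run f gf Q Psi d gd x0 L0 \<epsilon>
    using assms by unfold_locales (auto simp: is_arg_min_def)
  have unique: "\<exists>!s'. step s s'" if "ufgm_reachable f gf Q Psi d gd x0 L0 \<epsilon> s" for s
    using reachable_invariants[OF that] step_exists[OF _ solvable[OF that]] step_unique by blast
  have bounds: "st_L (s (Suc k)) \<le> 2 * gamma_gauge f (\<epsilon> * \<tau> k) \<and>
      \<tau> (Suc k) \<le> \<tau> k \<and> \<tau> k \<le> 2 / (real k + 1) \<and> st_y (s k) \<in> Q \<and>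
      (\<exists>v. minimizes (st_phi (s k)) v \<and>
           st_A (s k) * (f (st_y (s k)) + Psi (st_y (s k)) - 1 / 2 * \<epsilon>) \<le> st_phi (s k) v)"
    if run: "ufgm_run f gf Q Psi d gd x0 L0 \<epsilon> s"
      and \<tau>: "\<forall>k. \<tau> k = st_a (s (Suc k)) / st_A (s (Suc k))" for s \<tau> k
  proof -
    have step: "step (s k) (s (Suc k))" for k using run by (simp add: ufgm_run_def)
    have inv: "wf_state (s k)" "certified (s k)" "L_bounded (s k)" for k
      using reachable_invariants[OF run_reachable[OF run]] by auto
    note pres = step_preserves(4-6)[OF inv solvable[OF run_reachable[OF run]] step]
    have A: "st_A (s (Suc k)) \<noteq> 0" for k
      using pres(1,2)[of k] wf_state_A_nonneg[OF inv(1), of k] by simp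
    have L: "st_L (s (Suc k)) * (st_a (s (Suc k)))\<^sup>2 = st_A (s (Suc k))"
      "st_L (s (Suc k)) \<le> 2 * gamma_gauge f (\<epsilon> * \<tau> k)" for k
      using inv(3)[of "Suc k"] A[of k] \<tau> by (auto simp: L_bounded_def)
    have "\<tau> (Suc k) \<le> \<tau> k"
      using step_ratio_le_previous[OF inv(1)[of "Suc k"] inv(3)[of "Suc k"] A[of k] pres(2)[of "Suc k"]
          _ pres(3)[of "Suc k"]] pres(1)[of "Suc k"] L(1)[of "Suc k"] \<tau> by simp
    moreover obtain v where v: "minimizes (st_phi (s k)) v"
      using solvable[OF run_reachable[OF run], of k] by (auto simp: ufgm_solvable_def)
    moreover have "st_A (s k) * (f (st_y (s k)) + Psi (st_y (s k)) - 1 / 2 * \<epsilon>) \<le> st_phi (s k) v"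
      using inv(2)[of k] minimizes_in[OF v] by (simp add: certified_def)
    moreover have "\<tau> k \<le> 2 / (real k + 1)" using run_step_ratio_le[OF run] \<tau> by simp
    moreover have "st_y (s k) \<in> Q" using inv(1)[of k] by (simp add: wf_state_def)
    ultimately show ?thesis using L(2)[of k] by blast
  qed
  show ?thesis
    by (intro conjI allI impI) (use unique bounds in blast)+
qed

end
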